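(* For an integer $m\ge2$ and a positive weight $w_m$, consider the inequality $$\|\mathbf{T}_g\|\le\Big(\sum_{\Omega(n)=m}|b_n|^2w_m(n)\Big)^{1/2}\quad\text{for every } m\text{-homogeneous Dirichlet series } g(s)=\sum_{\Omega(n)=m}b_nn^{-s}.\qquad(\ast)$$ (1) When $m=2$, the inequality $(\ast)$ holds with the weight function $$w_2(n)=C_2\frac{\log n}{\log_2n}$$ for an absolute constant $C_2$. This is sharp in the sense that one cannot replace $\log_2n$ by $(\log_2n)^{1+\varepsilon}$ for any $\varepsilon>0$: for every $\varepsilon>0$ there is no constant $C$ such that $(\ast)$ holds with $w_2(n)=C\log n/(\log_2n)^{1+\varepsilon}$. (2) When $m\ge3$, the inequality $(\ast)$ holds with $$w_m(n)=C_m\frac{n^{\frac{m-2}{m}}}{(\log n)^{m-2}}$$ for a constant $C_m$ depending only on $m$. This is also sharp in the sense that one cannot replace $(\log n)^{m-2}$ by $(\log n)^{m+\varepsilon-2}$ for any $\varepsilon>0$: for every $\varepsilon>0$ there is no constant $C$ such that $(\ast)$ holds with $w_m(n)=C\,n^{(m-2)/m}/(\log n)^{m+\varepsilon-2}$.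
   Context: $\Omega(n)$ is the number of prime factors of $n$ counted with multiplicity. $\log_2x=\log\log x$ for $x>e^e$, with the convention $\log_2x=1$ for $x\le e^e$. $\mathcal{H}^2$ is the Hilbert space of Dirichlet series $f(s)=\sum_{n\ge1}a_nn^{-s}$ with $\|f\|_{\mathcal{H}^2}^2=\sum_{n\ge1}|a_n|^2<\infty$. The Volterra operator with symbol $g$ is $\mathbf{T}_gf(s)=-\int_s^{+\infty}f(w)g'(w)\,dw$ (integral along the horizontal half-line from $s$, for $\mathrm{Re}\,s$ large enough), which is again a Dirichlet series; $\|\mathbf{T}_g\|$ denotes its operator norm on $\mathcal{H}^2$. The inequality $(\ast)$ asserts in particular that $\mathbf{T}_g$ is bounded on $\mathcal{H}^2$ whenever the right-hand side is finite. *)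

theory Defs
  imports "HOL-Analysis.Analysis" "HOL-Computational_Algebra.Computational_Algebra"
begin

text \<open>
  A Dirichlet series is given by its coefficients \<open>a :: nat \<Rightarrow> complex\<close>; the value \<open>a 0\<close> is
  ignored everywhere (in the series itself because \<open>0 powr z = 0\<close>).
\<close>

definition dirichlet_term :: "(nat \<Rightarrow> complex) \<Rightarrow> complex \<Rightarrow> nat \<Rightarrow> complex" where
  "dirichlet_term a s n = a n * of_nat n powr (- s)"

definition dirichlet :: "(nat \<Rightarrow> complex) \<Rightarrow> complex \<Rightarrow> complex" where
  "dirichlet a s = (\<Sum>n. dirichlet_term a s n)"

definition H2 :: "(nat \<Rightarrow> complex) set" where
  "H2 = {a. (\<lambda>n. (cmod (a n))\<^sup>2) summable_on {1..}}"

definition H2_norm :: "(nat \<Rightarrow> complex) \<Rightarrow> real" where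
  "H2_norm a = sqrt (\<Sum>\<^sub>\<infinity>n\<in>{1..}. (cmod (a n))\<^sup>2)"

text \<open>The half-line from \<open>s\<close> is parametrised by \<open>w = s + t\<close>, \<open>t \<ge> 0\<close>.\<close>

definition volterra_integrand ::
    "(complex \<Rightarrow> complex) \<Rightarrow> (complex \<Rightarrow> complex) \<Rightarrow> complex \<Rightarrow> real \<Rightarrow> complex" where
  "volterra_integrand g f s t = f (s + of_real t) * deriv g (s + of_real t)"

definition volterra :: "(complex \<Rightarrow> complex) \<Rightarrow> (complex \<Rightarrow> complex) \<Rightarrow> complex \<Rightarrow> complex" where
  "volterra g f s = - integral {0..} (volterra_integrand g f s)"

text \<open>
  The graph of the Volterra operator on Dirichlet series: if \<open>g\<close>, \<open>f\<close> have the coefficients \<open>b\<close>,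
  \<open>a\<close>, then \<open>volterra_graph b a c\<close> says that \<open>T\<^sub>g f\<close> is the Dirichlet series with coefficients
  \<open>c\<close>, all series and the integral being convergent for large real part of \<open>s\<close>.
  By the uniqueness theorem for Dirichlet series, \<open>c n\<close> is determined for \<open>n \<ge> 1\<close>.
\<close>

definition volterra_graph ::
    "(nat \<Rightarrow> complex) \<Rightarrow> (nat \<Rightarrow> complex) \<Rightarrow> (nat \<Rightarrow> complex) \<Rightarrow> bool" where
  "volterra_graph b a c \<longleftrightarrow>
     (\<exists>\<sigma>::real. \<forall>s. Re s > \<sigma> \<longrightarrow>
        summable (dirichlet_term b s) \<and> summable (dirichlet_term a s) \<and>
        volterra_integrand (dirichlet b) (dirichlet a) s integrable_on {0..} \<and>
        dirichlet_term c s sums volterra (dirichlet b) (dirichlet a) s)"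

definition volterra_bounded :: "(nat \<Rightarrow> complex) \<Rightarrow> bool" where
  "volterra_bounded b \<longleftrightarrow>
     (\<exists>K. \<forall>a\<in>H2. \<exists>c\<in>H2. volterra_graph b a c \<and> H2_norm c \<le> K * H2_norm a)"

text \<open>The operator norm; a real supremum, hence meaningful only together with
  \<^const>\<open>volterra_bounded\<close>.\<close>

definition volterra_norm :: "(nat \<Rightarrow> complex) \<Rightarrow> real" where
  "volterra_norm b = Sup {H2_norm c | a c. a \<in> H2 \<and> H2_norm a \<le> 1 \<and> volterra_graph b a c}"

definition Omega :: "nat \<Rightarrow> nat" where
  "Omega n = size (prime_factorization n)"

definition homogeneous :: "nat \<Rightarrow> (nat \<Rightarrow> complex) \<Rightarrow> bool" where
  "homogeneous m b \<longleftrightarrow> (\<forall>n\<ge>1. b n \<noteq> 0 \<longrightarrow> Omega n = m)"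

text \<open>
  The inequality between \<open>\<parallel>T\<^sub>g\<parallel>\<close> and the weighted sum. It is vacuous when the right-hand side is
  infinite; when it is finite, boundedness of \<open>T\<^sub>g\<close> is part of the assertion. The set
  \<open>{n. n \<ge> 1 \<and> Omega n = m}\<close> contains \<open>n \<ge> 1\<close> explicitly since \<open>Omega 0 = 0\<close> here.
\<close>

definition volterra_ineq :: "nat \<Rightarrow> (nat \<Rightarrow> real) \<Rightarrow> bool" where
  "volterra_ineq m w \<longleftrightarrow>
     (\<forall>b. homogeneous m b \<longrightarrow>
        (\<lambda>n. (cmod (b n))\<^sup>2 * w n) summable_on {n. n \<ge> 1 \<and> Omega n = m} \<longrightarrow>
        volterra_bounded b \<and>
        volterra_norm b \<le> sqrt (\<Sum>\<^sub>\<infinity>n\<in>{n. n \<ge> 1 \<and> Omega n = m}. (cmod (b n))\<^sup>2 * w n))"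

definition loglog :: "real \<Rightarrow> real" where
  "loglog x = (if x > exp (exp 1) then ln (ln x) else 1)"

end

theory Submission
  imports Defs "HOL-Real_Asymp.Real_Asymp"
begin

text \<open>
  If \<open>f\<close>, \<open>g\<close> have coefficients \<open>a\<close>, \<open>b\<close>, then \<open>T\<^sub>g f\<close> has the coefficients
  \<open>c\<^sub>N = (ln N)\<^sup>-\<^sup>1 \<Sum>\<^bsub>n | N\<^esub> b\<^sub>n (ln n) a\<^bsub>N/n\<^esub>\<close>. By Cauchy--Schwarz the inequality with weight \<open>w\<close> follows from
  \<open>\<Sum>\<^bsub>n | N, \<Omega>(n) = m\<^esub> (ln n)\<^sup>2 / w(n) \<le> (ln N)\<^sup>2\<close> for all \<open>N\<close>. For \<open>m = 2\<close> this holds because \<open>N\<close> has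
  \<open>O(ln N / ln ln N)\<close> distinct prime factors. For \<open>m \<ge> 3\<close> write \<open>n = P k\<close> with \<open>P\<close> the largest prime factor;
  since \<open>(ln x) x\<^sup>-\<^sup>\<delta>\<close> is almost decreasing, the powers of \<open>ln P\<close> and \<open>P\<close> can be distributed over the \<open>m - 1\<close>
  prime factors of \<open>k\<close>, which bounds the sum by \<open>\<Sum>\<^bsub>P | N\<^esub> ln P\<close> times the \<open>(m - 1)\<close>-st power of
  \<open>\<Sum>\<^bsub>p | N\<^esub> (ln p) p\<^sup>-\<^sup>\<eta>\<close> with \<open>\<eta> = (m - 2) / (m - 1)\<close>. Both factors are \<open>O(ln N)\<close>,
  the second one by Chebyshev's upper bound.

  For the sharpness let \<open>S\<close> consist of \<open>2 r \<approx> x / (4 ln x)\<close> primes in \<open>(\<surd>x, x]\<close>, let \<open>a\<close> be the indicator of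
  products of \<open>r\<close> elements of \<open>S\<close>, and let \<open>b\<close> be the indicator of products of \<open>m\<close> elements of \<open>S\<close>
  when \<open>m \<ge> 3\<close>, and of \<open>q p\<close> with \<open>p \<in> S\<close> and \<open>q\<close> a prime with \<open>ln q = x\<close> when \<open>m = 2\<close>.
\<close>

section \<open>Dirichlet series with polynomially bounded coefficients\<close>

text \<open>These are exactly the sequences whose Dirichlet series converges somewhere, and then it
  converges absolutely on a half-plane. The value at 0 stays free.\<close>

definition poly_growth :: "(nat \<Rightarrow> complex) \<Rightarrow> bool" where
  "poly_growth a \<longleftrightarrow> (\<exists>K d. \<forall>n\<ge>1. cmod (a n) \<le> K * real n ^ d)"

definition dconv :: "(nat \<Rightarrow> complex) \<Rightarrow> (nat \<Rightarrow> complex) \<Rightarrow> nat \<Rightarrow> complex" where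
  "dconv b a N = (\<Sum>n | n dvd N. b n * a (N div n))"

text \<open>Coefficients of minus the derivative of the series.\<close>

definition log_coeff :: "(nat \<Rightarrow> complex) \<Rightarrow> nat \<Rightarrow> complex" where
  "log_coeff b n = b n * of_real (ln (real n))"

text \<open>The integral of N^(-s-t) over t >= 0 is N^(-s) / ln N, whence the divisor. At N = 1 the
  convention x / 0 = 0 gives the value 0, as it should since g' has no constant term.\<close>

definition volterra_coeff :: "(nat \<Rightarrow> complex) \<Rightarrow> (nat \<Rightarrow> complex) \<Rightarrow> nat \<Rightarrow> complex" where
  "volterra_coeff b a N = dconv (log_coeff b) a N / of_real (ln (real N))"

lemma norm_dirichlet_term: "norm (dirichlet_term a s n) = cmod (a n) * real n powr (- Re s)"
proof -
  have "norm (complex_of_nat n powr (- s)) = real n powr (- Re s)"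
    using norm_powr_real_powr[of "of_nat n" "-s"] by simp
  then show ?thesis by (simp add: dirichlet_term_def norm_mult)
qed

lemma poly_growth_E:
  assumes "poly_growth a"
  obtains K d where "K \<ge> 0" "\<And>n. n \<ge> 1 \<Longrightarrow> cmod (a n) \<le> K * real n ^ d"
proof -
  from assms obtain K d where K: "\<forall>n\<ge>1. cmod (a n) \<le> K * real n ^ d"
    unfolding poly_growth_def by blast
  have "K \<ge> 0" using order_trans[OF norm_ge_zero K[rule_format, of 1]] by simp
  with K that show ?thesis by blast
qed

lemma poly_growth_summable:
  assumes "poly_growth a"
  obtains \<sigma> where "\<And>s. Re s > \<sigma> \<Longrightarrow> summable (\<lambda>n. norm (dirichlet_term a s n))"
proof -
  from poly_growth_E[OF assms] obtain K d where K: "K \<ge> 0" "\<And>n. n \<ge> 1 \<Longrightarrow> cmod (a n) \<le> K * real n ^ d"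
    by metis
  show ?thesis
  proof (rule that[of "real d + 1"])
    fix s assume s: "Re s > real d + 1"
    have "summable (\<lambda>n. K * real n powr (real d - Re s))"
      using s by (intro summable_mult) (simp add: summable_real_powr_iff)
    then show "summable (\<lambda>n. norm (dirichlet_term a s n))"
    proof (rule summable_comparison_test[rotated], intro exI[of _ 1] allI impI)
      fix n :: nat assume n: "1 \<le> n"
      have "norm (dirichlet_term a s n) \<le> (K * real n ^ d) * real n powr (- Re s)"
        unfolding norm_dirichlet_term using K n by (intro mult_right_mono) auto
      also have "\<dots> = K * real n powr (real d - Re s)"
        using n by (simp add: powr_realpow[symmetric] powr_add[symmetric] del: powr_realpow)
      finally show "norm (norm (dirichlet_term a s n)) \<le> K * real n powr (real d - Re s)" by simp
    qed
  qed
qed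

lemma poly_growth_mono:
  assumes "poly_growth a" "K \<ge> 0" "\<And>n. n \<ge> 1 \<Longrightarrow> cmod (b n) \<le> K * real n ^ d * cmod (a n)"
  shows "poly_growth b"
proof -
  from poly_growth_E[OF assms(1)] obtain L e where L: "L \<ge> 0" "\<And>n. n \<ge> 1 \<Longrightarrow> cmod (a n) \<le> L * real n ^ e"
    by metis
  have "cmod (b n) \<le> (K * L) * real n ^ (d + e)" if "n \<ge> 1" for n
  proof -
    have "cmod (b n) \<le> K * real n ^ d * (L * real n ^ e)"
      using assms(3)[OF that] L(2)[OF that] assms(2)
      by (meson mult_left_mono mult_nonneg_nonneg of_nat_0_le_iff order_trans zero_le_power)
    then show ?thesis by (simp add: power_add mult_ac)
  qed
  then show ?thesis unfolding poly_growth_def by blast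
qed

lemma poly_growth_log_coeff:
  assumes "poly_growth a" shows "poly_growth (log_coeff a)"
proof (rule poly_growth_mono[OF assms, of 1 _ 1])
  fix n :: nat assume "n \<ge> 1"
  then have "0 \<le> ln (real n)" "ln (real n) \<le> real n" using ln_le_minus_one[of "real n"] by auto
  then show "cmod (log_coeff a n) \<le> 1 * real n ^ 1 * cmod (a n)"
    unfolding log_coeff_def norm_mult using mult_right_mono[of "ln (real n)" "real n" "cmod (a n)"]
    by (simp add: mult.commute)
qed simp

lemma finite_divisors: "N \<ge> 1 \<Longrightarrow> finite {n::nat. n dvd N}"
  by (rule finite_divisors_nat) simp

lemma divisor_bounds:
  assumes "n dvd N" "N \<ge> (1::nat)"
  shows "n \<ge> 1" "n \<le> N" "N div n \<ge> 1" "N div n \<le> N"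
proof -
  show "n \<le> N" using assms dvd_imp_le by simp
  show "n \<ge> 1" using assms by (cases "n = 0") auto
  with \<open>n \<le> N\<close> show "N div n \<ge> 1" using div_le_mono[of n N n] by simp
qed simp

lemma poly_growth_dconv:
  assumes "poly_growth b" "poly_growth a" shows "poly_growth (dconv b a)"
proof -
  from poly_growth_E[OF assms(1)] obtain K d where K: "K \<ge> 0" "\<And>n. n \<ge> 1 \<Longrightarrow> cmod (b n) \<le> K * real n ^ d"
    by metis
  from poly_growth_E[OF assms(2)] obtain L e where L: "L \<ge> 0" "\<And>n. n \<ge> 1 \<Longrightarrow> cmod (a n) \<le> L * real n ^ e"
    by metis
  have "cmod (dconv b a N) \<le> (K * L) * real N ^ (d + e + 1)" if N: "N \<ge> 1" for N
  proof -
    have "cmod (dconv b a N) \<le> (\<Sum>n | n dvd N. (K * real N ^ d) * (L * real N ^ e))"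
      unfolding dconv_def
    proof (rule sum_norm_le)
      fix n assume "n \<in> {n. n dvd N}"
      then have n: "n dvd N" by simp
      then have 1: "n \<ge> 1" "n \<le> N" "N div n \<ge> 1" "N div n \<le> N"
        using divisor_bounds[OF n N] by auto
      have "cmod (b n) \<le> K * real N ^ d" "cmod (a (N div n)) \<le> L * real N ^ e"
        using 1(2,4) K(1) L(1)
        by (auto intro!: order_trans[OF K(2)[OF 1(1)]] order_trans[OF L(2)[OF 1(3)]] mult_left_mono power_mono)
      then show "cmod (b n * a (N div n)) \<le> (K * real N ^ d) * (L * real N ^ e)"
        unfolding norm_mult using K L by (intro mult_mono) auto
    qed
    also have "\<dots> = real (card {n. n dvd N}) * ((K * real N ^ d) * (L * real N ^ e))" by simp
    also have "\<dots> \<le> real N * ((K * real N ^ d) * (L * real N ^ e))"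
    proof (rule mult_right_mono)
      have "{n. n dvd N} \<subseteq> {1..N}" using divisor_bounds[OF _ N] by auto
      then have "card {n. n dvd N} \<le> card {1..N}" by (intro card_mono) auto
      then show "real (card {n. n dvd N}) \<le> real N" by simp
    qed (use K L in auto)
    finally show ?thesis by (simp add: power_add mult_ac)
  qed
  then show ?thesis unfolding poly_growth_def by blast
qed

lemma poly_growth_volterra_coeff:
  assumes "poly_growth b" "poly_growth a" shows "poly_growth (volterra_coeff b a)"
\<comment> \<open>For N >= 2 the divisor is at least ln 2; at N = 1 the coefficient is 0.\<close>
proof (rule poly_growth_mono[OF poly_growth_dconv[OF poly_growth_log_coeff[OF assms(1)] assms(2)], of "1 / ln 2" _ 0])
  fix n :: nat assume n: "n \<ge> 1"
  show "cmod (volterra_coeff b a n) \<le> 1 / ln 2 * real n ^ 0 * cmod (dconv (log_coeff b) a n)"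
  proof (cases "n = 1")
    case False
    with n have "ln 2 \<le> ln (real n)" by simp
    then show ?thesis unfolding volterra_coeff_def norm_divide
      using n False by (simp add: frac_le)
  qed (simp add: volterra_coeff_def)
qed simp

text \<open>The terms of a convergent series are bounded, so |a_n| is at most a constant times n^(Re
  s); the exponent is rounded up to a natural number.\<close>

lemma poly_growth_if_summable:
  assumes "summable (dirichlet_term a s)" shows "poly_growth a"
proof -
  have "Bseq (dirichlet_term a s)"
    using assms summable_LIMSEQ_zero convergentI convergent_imp_Bseq by blast
  then obtain K where K: "K > 0" "\<And>n. norm (dirichlet_term a s n) \<le> K" by (auto simp: Bseq_def)
  define d where "d = nat \<lceil>Re s\<rceil>"
  have "cmod (a n) \<le> K * real n ^ d" if n: "n \<ge> 1" for n
  proof -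
    have "cmod (a n) * real n powr (- Re s) \<le> K" using K(2)[of n] by (simp add: norm_dirichlet_term)
    then have "cmod (a n) \<le> K * real n powr (Re s)" using n by (simp add: powr_minus field_simps)
    also have "real n powr (Re s) \<le> real n powr (real d)" using n by (intro powr_mono) (auto simp: d_def, linarith)
    also have "\<dots> = real n ^ d" using n by (simp add: powr_realpow)
    finally show ?thesis using K by (simp add: mult_left_mono)
  qed
  then show ?thesis unfolding poly_growth_def by blast
qed

section \<open>Decay along horizontal half-lines and uniqueness of the coefficients\<close>

lemma dirichlet_term_shift:
  assumes "t \<ge> 0" "k \<ge> 1" "\<And>n. 1 \<le> n \<Longrightarrow> n < k \<Longrightarrow> e n = 0"
  shows "norm (dirichlet_term e (s + of_real t) n) \<le> real k powr (- t) * norm (dirichlet_term e s n)"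
proof (cases "n \<ge> k")
  case True
  have "real n powr (- t) \<le> real k powr (- t)" using True assms by (intro powr_mono2') auto
  then have "(cmod (e n) * real n powr (- Re s)) * real n powr (- t)
      \<le> (cmod (e n) * real n powr (- Re s)) * real k powr (- t)" by (intro mult_left_mono) auto
  moreover have "real n powr (- Re (s + of_real t)) = real n powr (- Re s) * real n powr (- t)"
    by (simp flip: powr_add)
  ultimately show ?thesis unfolding norm_dirichlet_term by (simp add: mult_ac)
next
  case False
  then show ?thesis using assms(3)[of n] unfolding norm_dirichlet_term by (cases "n = 0") auto
qed

text \<open>Moving s to s + t multiplies the n-th term by n^(-t), which is at most k^(-t) on the
  indices n >= k that occur. With k = 2 this makes the Volterra integral converge; with k + 1 it
  isolates the k-th coefficient in the uniqueness proof.\<close>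

lemma dirichlet_decay:
  assumes "summable (\<lambda>n. norm (dirichlet_term e s n))" "t \<ge> 0" "k \<ge> 1" "\<And>n. 1 \<le> n \<Longrightarrow> n < k \<Longrightarrow> e n = 0"
  shows "norm (dirichlet e (s + of_real t)) \<le> real k powr (- t) * (\<Sum>n. norm (dirichlet_term e s n))"
proof -
  have *: "norm (dirichlet_term e (s + of_real t) n) \<le> real k powr (- t) * norm (dirichlet_term e s n)" for n
    by (rule dirichlet_term_shift) (use assms in auto)
  have s1: "summable (\<lambda>n. real k powr (- t) * norm (dirichlet_term e s n))"
    using assms(1) by (rule summable_mult)
  have s2: "summable (\<lambda>n. norm (dirichlet_term e (s + of_real t) n))"
    by (rule summable_comparison_test[OF _ s1]) (use * in auto)
  have "norm (dirichlet e (s + of_real t)) \<le> (\<Sum>n. norm (dirichlet_term e (s + of_real t) n))"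
    unfolding dirichlet_def by (rule summable_norm[OF s2])
  also have "\<dots> \<le> (\<Sum>n. real k powr (- t) * norm (dirichlet_term e s n))"
    by (rule suminf_le[OF * s2 s1])
  also have "\<dots> = real k powr (- t) * (\<Sum>n. norm (dirichlet_term e s n))"
    using assms(1) by (rule suminf_mult)
  finally show ?thesis .
qed

text \<open>Induction on the index: once the earlier coefficients vanish, the k-th term equals minus
  a tail of size O((k+1)^(-t)) at s + t. Multiplying by k^t and letting t tend to infinity gives d_k
  = 0.\<close>

lemma dirichlet_unique:
  assumes 0: "\<And>s. Re s > \<sigma> \<Longrightarrow> dirichlet_term d s sums 0" and n: "n \<ge> 1"
  shows "d n = 0"
  using n
proof (induction n rule: less_induct)
  case (less k)
  have "poly_growth d" using 0[of "of_real (\<sigma> + 1)"] poly_growth_if_summable sums_summable by force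
  then obtain \<tau> where \<tau>: "\<And>s. Re s > \<tau> \<Longrightarrow> summable (\<lambda>n. norm (dirichlet_term d s n))"
    using poly_growth_summable by metis
  define s where "s = complex_of_real (max \<sigma> \<tau> + 1)"
  \<comment> \<open>By the induction hypothesis this remainder starts at index k + 1.\<close>
  define e where "e = d(k := 0)"
  have s: "Re s > \<sigma>" "Re s > \<tau>" unfolding s_def by auto
  have e0: "e i = 0" if "1 \<le> i" "i < Suc k" for i
    using that less.IH[of i] by (auto simp: e_def)
  have es: "summable (\<lambda>n. norm (dirichlet_term e s n))"
    by (rule summable_comparison_test[OF _ \<tau>[OF s(2)]]) (auto simp: e_def dirichlet_term_def)
  define M where "M = (\<Sum>n. norm (dirichlet_term e s n))"
  have bound: "cmod (d k) * real k powr (- Re s) \<le> (real k / real (Suc k)) powr t * M" if t: "t \<ge> 0" for t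
  proof -
    let ?s = "s + of_real t"
    have "dirichlet_term d ?s sums 0" using s t by (intro 0) auto
    moreover have "(\<lambda>n. if n = k then dirichlet_term d ?s k else 0) sums (dirichlet_term d ?s k)"
      using sums_single[of k "\<lambda>n. dirichlet_term d ?s k"] by simp
    ultimately have "(\<lambda>n. dirichlet_term d ?s n - (if n = k then dirichlet_term d ?s k else 0)) sums (0 - dirichlet_term d ?s k)"
      by (rule sums_diff)
    also have "(\<lambda>n. dirichlet_term d ?s n - (if n = k then dirichlet_term d ?s k else 0)) = dirichlet_term e ?s"
      by (auto simp: e_def dirichlet_term_def)
    finally have "dirichlet e ?s = - dirichlet_term d ?s k"
      unfolding dirichlet_def by (simp add: sums_iff)
    then have "norm (dirichlet_term d ?s k) \<le> real (Suc k) powr (- t) * M"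
      using dirichlet_decay[OF es t, of "Suc k"] e0 by (simp add: M_def)
    then have "cmod (d k) * real k powr (- Re s) * real k powr (- t) \<le> real (Suc k) powr (- t) * M"
      unfolding norm_dirichlet_term by (simp add: powr_add[symmetric] mult.assoc)
    then have "(cmod (d k) * real k powr (- Re s) * real k powr (- t)) * real k powr t \<le> (real (Suc k) powr (- t) * M) * real k powr t"
      by (rule mult_right_mono) simp
    then show ?thesis using less.prems by (simp add: powr_divide powr_minus divide_simps mult_ac)
  qed
  have "((\<lambda>t. (real k / real (Suc k)) powr t * M) \<longlongrightarrow> 0 * M) at_top"
  proof (intro tendsto_mult tendsto_const)
    have "((\<lambda>t. exp (t * ln (real k / real (Suc k)))) \<longlongrightarrow> 0) at_top"
    proof (rule filterlim_compose[OF exp_at_bot])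
      have "ln (real k / real (Suc k)) < 0" using less.prems by (intro ln_less_zero) auto
      then have "LIM t at_top. ln (real k / real (Suc k)) * t :> at_bot"
        by (rule filterlim_tendsto_neg_mult_at_bot[OF tendsto_const _ filterlim_ident])
      then show "LIM t at_top. t * ln (real k / real (Suc k)) :> at_bot"
        by (simp only: mult.commute[of _ "ln (real k / real (Suc k))"])
    qed
    then show "((\<lambda>t. (real k / real (Suc k)) powr t) \<longlongrightarrow> 0) at_top"
      using less.prems by (simp add: powr_def)
  qed
  moreover have "\<forall>\<^sub>F t in at_top. cmod (d k) * real k powr (- Re s) \<le> (real k / real (Suc k)) powr t * M"
    by (rule eventually_mono[OF eventually_ge_at_top[of 0] bound])
  ultimately have "cmod (d k) * real k powr (- Re s) \<le> 0"
    by (intro tendsto_lowerbound[where F = at_top]) auto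
  moreover have "real k powr (- Re s) > 0" using less.prems by simp
  ultimately show "d k = 0"
    by (smt (verit) mult_pos_pos zero_less_norm_iff)
qed

text \<open>Termwise differentiation: on a closed half-plane the differentiated series is dominated
  by its absolute values at the real boundary point \<open>s0\<close>, hence converges uniformly.
  Interior points of the half-plane then have the full derivative.\<close>

lemma dirichlet_has_derivative:
  assumes "poly_growth a"
  obtains \<sigma> where "\<And>s. Re s > \<sigma> \<Longrightarrow> (dirichlet a has_field_derivative - dirichlet (log_coeff a) s) (at s)"
proof -
  obtain \<sigma>1 where \<sigma>1: "\<And>s. Re s > \<sigma>1 \<Longrightarrow> summable (\<lambda>n. norm (dirichlet_term a s n))"
    using poly_growth_summable[OF assms] by metis
  obtain \<sigma>2 where \<sigma>2: "\<And>s. Re s > \<sigma>2 \<Longrightarrow> summable (\<lambda>n. norm (dirichlet_term (log_coeff a) s n))"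
    using poly_growth_summable[OF poly_growth_log_coeff[OF assms]] by metis
  define \<tau> where "\<tau> = max \<sigma>1 \<sigma>2 + 1"
  define s0 where "s0 = complex_of_real \<tau>"
  define S where "S = {s. Re s \<ge> \<tau>}"
  have \<tau>: "Re s0 > \<sigma>1" "Re s0 > \<sigma>2" by (auto simp: s0_def \<tau>_def)
  have "convex S" unfolding S_def by (rule convex_halfspace_Re_ge)
  have interior: "s \<in> interior S" if "Re s > \<tau>" for s
    by (rule interiorI[of "{s. Re s > \<tau>}"]) (use that in \<open>auto simp: S_def open_halfspace_Re_gt\<close>)
  show ?thesis
  proof (rule that[of \<tau>])
    fix s assume s: "Re s > \<tau>"
    have "((\<lambda>s. \<Sum>n. dirichlet_term a s n) has_field_derivative (\<Sum>n. - dirichlet_term (log_coeff a) s n)) (at s)"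
    proof (rule Derivative.has_field_derivative_series'(2)[where f = "\<lambda>n x. dirichlet_term a x n"
          and f' = "\<lambda>n x. - dirichlet_term (log_coeff a) x n" and S = S and x = s and ?x0.0 = s0])
      show "convex S" by fact
    next
      fix n :: nat and x assume "x \<in> S"
      show "((\<lambda>x. dirichlet_term a x n) has_field_derivative - dirichlet_term (log_coeff a) x n) (at x within S)"
      proof (cases "n = 0")
        case True
        then show ?thesis by (simp add: dirichlet_term_def)
      next
        case False
        have "((\<lambda>x. complex_of_nat n powr (- x)) has_field_derivative
                (Ln (of_nat n) * of_nat n powr (- x)) * (- 1)) (at x within S)"
          by (rule DERIV_chain2[OF has_field_derivative_powr_right])
             (use False in \<open>auto intro!: derivative_eq_intros\<close>)
        from DERIV_cmult[OF this, of "a n"] show ?thesis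
          using False by (simp add: dirichlet_term_def log_coeff_def Ln_of_nat mult_ac)
      qed
    next
      have "uniform_limit S (\<lambda>n x. \<Sum>i<n. - dirichlet_term (log_coeff a) x i)
              (\<lambda>x. \<Sum>i. - dirichlet_term (log_coeff a) x i) sequentially"
      proof (rule Weierstrass_m_test)
        show "summable (\<lambda>n. norm (dirichlet_term (log_coeff a) s0 n))" by (rule \<sigma>2[OF \<tau>(2)])
        fix n x assume "x \<in> S"
        then have *: "Re x \<ge> Re s0" by (simp add: S_def s0_def)
        show "norm (- dirichlet_term (log_coeff a) x n) \<le> norm (dirichlet_term (log_coeff a) s0 n)"
        proof (cases "n = 0")
          case False
          then show ?thesis unfolding norm_minus_cancel norm_dirichlet_term using *
            by (intro mult_left_mono powr_mono) auto
        qed (simp add: dirichlet_term_def)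
      qed
      then show "uniformly_convergent_on S (\<lambda>n x. \<Sum>i<n. - dirichlet_term (log_coeff a) x i)"
        by (auto simp: uniformly_convergent_on_def)
      show "s0 \<in> S" by (simp add: s0_def S_def)
      show "summable (dirichlet_term a s0)" using \<sigma>1[OF \<tau>(1)] by (rule summable_norm_cancel)
      show "s \<in> interior S" by (rule interior[OF s])
    qed
    moreover have "(\<Sum>n. - dirichlet_term (log_coeff a) s n) = - dirichlet (log_coeff a) s"
      unfolding dirichlet_def using s
      by (intro suminf_minus summable_norm_cancel[OF \<sigma>2]) (auto simp: \<tau>_def)
    ultimately show "(dirichlet a has_field_derivative - dirichlet (log_coeff a) s) (at s)"
      by (simp add: dirichlet_def[abs_def])
  qed
qed

section \<open>Products of Dirichlet series\<close>

lemma has_sum_times: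
  fixes f :: "'a \<Rightarrow> 'c::{real_normed_field,banach}" and g :: "'b \<Rightarrow> 'c"
  assumes "(\<lambda>x. norm (f x)) summable_on A" "(\<lambda>x. norm (g x)) summable_on B" "(f has_sum S) A" "(g has_sum T) B"
  shows "((\<lambda>(x, y). f x * g y) has_sum (S * T)) (A \<times> B)"
proof (rule has_sum_SigmaI)
  show "((\<lambda>y. case (x, y) of (x, y) \<Rightarrow> f x * g y) has_sum (f x * T)) B" for x
    using has_sum_cmult_right[OF assms(4), of "f x"] by simp
  show "((\<lambda>x. f x * T) has_sum (S * T)) A" by (rule has_sum_cmult_left[OF assms(3)])
  have "(\<lambda>z. norm (case z of (x, y) \<Rightarrow> f x * g y)) summable_on A \<times> B"
  proof (rule Infinite_Sum.abs_summable_on_Sigma_iff[THEN iffD2], intro conjI ballI)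
    show "(\<lambda>y. norm (case (x, y) of (x, y) \<Rightarrow> f x * g y)) summable_on B" for x
      using summable_on_cmult_right[OF assms(2)] by (simp add: norm_mult)
    have "(\<lambda>x. norm (f x) * (\<Sum>\<^sub>\<infinity>y\<in>B. norm (g y))) summable_on A"
      by (rule summable_on_cmult_left[OF assms(1)])
    then show "(\<lambda>x. norm (\<Sum>\<^sub>\<infinity>y\<in>B. norm (case (x, y) of (x, y) \<Rightarrow> f x * g y))) summable_on A"
      by (simp add: norm_mult infsum_cmult_right' infsum_nonneg abs_mult)
  qed
  then show "(\<lambda>(x, y). f x * g y) summable_on A \<times> B" by (rule Infinite_Sum.abs_summable_summable)
qed

text \<open>Groups the pairs (n, k) by their product N = n k. It serves twice: for the product of
  two Dirichlet series and for summing the norm bound for T_g over N.\<close>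

lemma has_sum_divisors:
  fixes h :: "nat \<Rightarrow> nat \<Rightarrow> 'a :: {topological_comm_monoid_add, t3_space}"
  assumes "((\<lambda>(n, k). h n k) has_sum S) ({1..} \<times> {1..})"
  shows "((\<lambda>N. \<Sum>n | n dvd N. h n (N div n)) has_sum S) {1..}"
proof -
  have "((\<lambda>(N, n). h n (N div n)) has_sum S) (SIGMA N:{1..}. {n. n dvd N})"
    using assms
  proof (subst (asm) has_sum_reindex_bij_witness[where i = "\<lambda>(N, n). (n, N div n)" and j = "\<lambda>(n, k). (n * k, n)"
      and T = "SIGMA N:{1..}. {n. n dvd N}" and h = "\<lambda>(N, n). h n (N div n)" and s' = S])
    fix b :: "nat \<times> nat" assume b: "b \<in> (SIGMA N:{1..}. {n. n dvd N})"
    then show "(case b of (N, n) \<Rightarrow> (n, N div n)) \<in> {1..} \<times> {1..}"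
      using divisor_bounds[of "snd b" "fst b"] by auto
  qed auto
  then show ?thesis
    by (rule has_sum_SigmaD) (use finite_divisors in \<open>auto intro!: has_sum_finiteI\<close>)
qed

lemma dirichlet_mult:
  assumes "summable (\<lambda>n. norm (dirichlet_term b s n))" "summable (\<lambda>n. norm (dirichlet_term a s n))"
  shows "dirichlet_term (dconv b a) s sums (dirichlet b s * dirichlet a s)"
proof -
  have 1: "(dirichlet_term c s has_sum dirichlet c s) {1..}"
    if "summable (\<lambda>n. norm (dirichlet_term c s n))" for c
  proof -
    have "(dirichlet_term c s has_sum dirichlet c s) UNIV"
      unfolding dirichlet_def
      by (intro norm_summable_imp_has_sum[OF that] summable_sums summable_norm_cancel[OF that])
    \<comment> \<open>Index 0 contributes nothing because \<open>0 powr z = 0\<close>.\<close>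
    also have "?this \<longleftrightarrow> ?thesis"
      by (rule has_sum_cong_neutral) (auto simp: dirichlet_term_def not_less_eq_eq)
    finally show ?thesis .
  qed
  have 2: "(\<lambda>n. norm (dirichlet_term c s n)) summable_on {1..}"
    if "summable (\<lambda>n. norm (dirichlet_term c s n))" for c
  proof (rule summable_on_subset_banach)
    show "(\<lambda>n. norm (dirichlet_term c s n)) summable_on UNIV"
      by (rule norm_summable_imp_summable_on) (use that in simp)
  qed simp
  have "((\<lambda>(n, k). dirichlet_term b s n * dirichlet_term a s k) has_sum (dirichlet b s * dirichlet a s)) ({1..} \<times> {1..})"
    by (intro has_sum_times 1 2 assms)
  then have "((\<lambda>N. \<Sum>n | n dvd N. dirichlet_term b s n * dirichlet_term a s (N div n)) has_sum (dirichlet b s * dirichlet a s)) {1..}"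
    by (rule has_sum_divisors)
  also have "?this \<longleftrightarrow> (dirichlet_term (dconv b a) s has_sum (dirichlet b s * dirichlet a s)) UNIV"
  proof (rule has_sum_cong_neutral)
    fix N :: nat assume "N \<in> {1..} \<inter> UNIV"
    then have N: "N \<ge> 1" by simp
    have "dirichlet_term b s n * dirichlet_term a s (N div n) = b n * a (N div n) * of_nat N powr (- s)" if "n dvd N" for n
    proof -
      have "of_nat N = (of_nat n * of_nat (N div n) :: complex)"
        using that by (metis dvd_mult_div_cancel of_nat_mult)
      then have "of_nat N powr (- s) = of_nat n powr (- s) * of_nat (N div n) powr (- s :: complex)"
        by (simp add: powr_times_real)
      then show ?thesis by (simp add: dirichlet_term_def)
    qed
    then have "(\<Sum>n | n dvd N. dirichlet_term b s n * dirichlet_term a s (N div n)) =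
        (\<Sum>n | n dvd N. b n * a (N div n) * of_nat N powr (- s))"
      by (intro sum.cong) auto
    then show "(\<Sum>n | n dvd N. dirichlet_term b s n * dirichlet_term a s (N div n)) = dirichlet_term (dconv b a) s N"
      by (simp add: dirichlet_term_def dconv_def sum_distrib_right)
  qed (auto simp: dirichlet_term_def not_less_eq_eq)
  finally show ?thesis by (rule has_sum_imp_sums)
qed

section \<open>The coefficients of T_g f\<close>

lemma dconv_log_coeff_Suc_0 [simp]: "dconv (log_coeff b) a (Suc 0) = 0"
  by (simp add: dconv_def log_coeff_def)

text \<open>Differentiating the series with coefficients \<open>volterra_coeff b a\<close> thus
  yields f g'. At n = 1 both sides are 0.\<close>

lemma log_coeff_volterra_coeff:
  "n \<ge> 1 \<Longrightarrow> log_coeff (volterra_coeff b a) n = dconv (log_coeff b) a n"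
  by (cases "n = 1") (auto simp: log_coeff_def volterra_coeff_def)

text \<open>The series of \<open>c\<close> is an antiderivative of f g' that tends to 0 along the
  half-line. The integral is evaluated on [0, k] by the fundamental theorem, and k tends to infinity
  by dominated convergence.\<close>

lemma volterra_coeff_graph:
  assumes b: "poly_growth b" and a: "poly_growth a"
  shows "volterra_graph b a (volterra_coeff b a)"
proof -
  define c where "c = volterra_coeff b a"
  define e where "e = dconv (log_coeff b) a"
  have growth: "poly_growth c" "poly_growth e" "poly_growth (log_coeff b)"
    unfolding c_def e_def using assms
    by (auto intro: poly_growth_volterra_coeff poly_growth_dconv poly_growth_log_coeff)
  obtain \<sigma>a where \<sigma>a: "\<And>s. Re s > \<sigma>a \<Longrightarrow> summable (\<lambda>n. norm (dirichlet_term a s n))"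
    using poly_growth_summable[OF a] by metis
  obtain \<sigma>b where \<sigma>b: "\<And>s. Re s > \<sigma>b \<Longrightarrow> summable (\<lambda>n. norm (dirichlet_term b s n))"
    using poly_growth_summable[OF b] by metis
  obtain \<sigma>c where \<sigma>c: "\<And>s. Re s > \<sigma>c \<Longrightarrow> summable (\<lambda>n. norm (dirichlet_term c s n))"
    using poly_growth_summable[OF growth(1)] by metis
  obtain \<sigma>e where \<sigma>e: "\<And>s. Re s > \<sigma>e \<Longrightarrow> summable (\<lambda>n. norm (dirichlet_term e s n))"
    using poly_growth_summable[OF growth(2)] by metis
  obtain \<sigma>l where \<sigma>l: "\<And>s. Re s > \<sigma>l \<Longrightarrow> summable (\<lambda>n. norm (dirichlet_term (log_coeff b) s n))"
    using poly_growth_summable[OF growth(3)] by metis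
  obtain \<sigma>g where \<sigma>g: "\<And>s. Re s > \<sigma>g \<Longrightarrow> (dirichlet b has_field_derivative - dirichlet (log_coeff b) s) (at s)"
    using dirichlet_has_derivative[OF b] by metis
  obtain \<sigma>h where \<sigma>h: "\<And>s. Re s > \<sigma>h \<Longrightarrow> (dirichlet c has_field_derivative - dirichlet (log_coeff c) s) (at s)"
    using dirichlet_has_derivative[OF growth(1)] by metis
  define \<sigma> where "\<sigma> = Max {\<sigma>a, \<sigma>b, \<sigma>c, \<sigma>e, \<sigma>l, \<sigma>g, \<sigma>h}"
  have "dirichlet_term (log_coeff c) s = dirichlet_term e s" for s
  proof
    fix n show "dirichlet_term (log_coeff c) s n = dirichlet_term e s n"
      using log_coeff_volterra_coeff[of n b a] by (cases "n = 0") (auto simp: c_def e_def dirichlet_term_def)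
  qed
  then have ce: "dirichlet (log_coeff c) = dirichlet e" by (simp add: dirichlet_def fun_eq_iff)
  have main: "volterra_integrand (dirichlet b) (dirichlet a) s integrable_on {0..} \<and>
      volterra (dirichlet b) (dirichlet a) s = dirichlet c s" if s: "Re s > \<sigma>" for s
  proof -
    have \<sigma>: "Re (s + of_real t) > \<sigma>a" "Re (s + of_real t) > \<sigma>b" "Re (s + of_real t) > \<sigma>c" "Re (s + of_real t) > \<sigma>e"
       "Re (s + of_real t) > \<sigma>l" "Re (s + of_real t) > \<sigma>g" "Re (s + of_real t) > \<sigma>h" if "t \<ge> 0" for t
      using s that unfolding \<sigma>_def by auto
    define h where "h = volterra_integrand (dirichlet b) (dirichlet a) s"
    have h: "h t = - dirichlet e (s + of_real t)" if t: "t \<ge> 0" for t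
    proof -
      have "deriv (dirichlet b) (s + of_real t) = - dirichlet (log_coeff b) (s + of_real t)"
        by (rule DERIV_imp_deriv[OF \<sigma>g[OF \<sigma>(6)[OF t]]])
      moreover have "dirichlet e (s + of_real t) = dirichlet (log_coeff b) (s + of_real t) * dirichlet a (s + of_real t)"
        unfolding e_def dirichlet_def[of "dconv _ _"]
        by (rule sums_unique[symmetric], rule dirichlet_mult) (use \<sigma>[OF t] \<sigma>l \<sigma>a in auto)
      ultimately show ?thesis by (simp add: h_def volterra_integrand_def)
    qed
    define M where "M = (\<Sum>n. norm (dirichlet_term e s n))"
    define Mc where "Mc = (\<Sum>n. norm (dirichlet_term c s n))"
    \<comment> \<open>Since e 1 = 0 the series starts at index 2, so the integrand is O(2^(-t)),
      written as an exponential whose integral over the half-line is known.\<close>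
    have decay_e: "norm (dirichlet e (s + of_real t)) \<le> exp (- ln 2 * t) * M" if "t \<ge> 0" for t
      using dirichlet_decay[OF \<sigma>e that, of s 2] \<sigma>(4)[of 0]
      by (simp add: e_def M_def powr_def mult.commute numeral_2_eq_2 less_Suc_eq)
    have decay_c: "norm (dirichlet c (s + of_real t)) \<le> 2 powr (- t) * Mc" if "t \<ge> 0" for t
      using dirichlet_decay[OF \<sigma>c that, of s 2] \<sigma>(3)[of 0]
      by (simp add: c_def Mc_def numeral_2_eq_2 less_Suc_eq volterra_coeff_def)
    have ftc: "(h has_integral (dirichlet c (s + of_real (real k)) - dirichlet c s)) {0..real k}" for k
    proof -
      have "((\<lambda>t. dirichlet c (s + of_real t)) has_vector_derivative h t) (at t within {0..real k})" if "t \<in> {0..real k}" for t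
      proof -
        have "(dirichlet c has_field_derivative h t) (at (of_real t + s))"
          using \<sigma>h[OF \<sigma>(7), of t] that by (simp add: ce h add.commute)
        then have "((\<lambda>z. dirichlet c (z + s)) has_field_derivative h t) (at (of_real t))"
          by (simp only: DERIV_shift)
        from has_vector_derivative_real_field[OF this] show ?thesis by (simp only: add.commute[of s])
      qed
      from fundamental_theorem_of_calculus[OF _ this] show ?thesis by simp
    qed
    \<comment> \<open>Truncating the integrand to [0, k] puts all functions on the same half-line,
      under one integrable majorant.\<close>
    have "(h has_integral (0 - dirichlet c s)) {0..}"
    proof (rule has_integral_dominated_convergence)
      show "((\<lambda>t. if t \<in> {0..real k} then h t else 0) has_integral (dirichlet c (s + of_real (real k)) - dirichlet c s)) {0..}" for k
        using ftc[of k] by (subst has_integral_restrict) auto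
      show "(\<lambda>t. exp (- ln 2 * t) * M) integrable_on {0..}"
        using has_integral_exp_minus_to_infinity[of "ln 2" 0] by (intro integrable_on_mult_left) (auto simp: integrable_on_def)
      have "M \<ge> 0" unfolding M_def by (rule suminf_nonneg[OF \<sigma>e]) (use s \<sigma>(4)[of 0] in auto)
      then show "\<forall>t\<in>{0..}. norm (if t \<in> {0..real k} then h t else 0) \<le> exp (- ln 2 * t) * M" for k
        using decay_e by (auto simp: h)
      show "\<forall>t\<in>{0..}. (\<lambda>k. if t \<in> {0..real k} then h t else 0) \<longlonglongrightarrow> h t"
      proof
        fix t :: real assume t: "t \<in> {0..}"
        obtain k0 where "real k0 \<ge> t" using real_arch_simple by blast
        then have "\<forall>\<^sub>F k in sequentially. (if t \<in> {0..real k} then h t else 0) = h t"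
          using t by (intro eventually_sequentiallyI[of k0]) auto
        then show "(\<lambda>k. if t \<in> {0..real k} then h t else 0) \<longlonglongrightarrow> h t" by (rule tendsto_eventually)
      qed
      have "(\<lambda>k. dirichlet c (s + of_real (real k))) \<longlonglongrightarrow> 0"
      proof (rule Lim_null_comparison)
        show "\<forall>\<^sub>F k in sequentially. norm (dirichlet c (s + of_real (real k))) \<le> 2 powr (- real k) * Mc"
          by (intro always_eventually allI decay_c) simp
        have "(\<lambda>k. (1 / 2 :: real) ^ k) \<longlonglongrightarrow> 0" by (rule LIMSEQ_realpow_zero) auto
        then have "(\<lambda>k. 2 powr (- real k)) \<longlonglongrightarrow> 0" by (simp add: powr_minus powr_realpow power_divide inverse_eq_divide)
        then show "(\<lambda>k. 2 powr (- real k) * Mc) \<longlonglongrightarrow> 0" by (rule tendsto_mult_left_zero)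
      qed
      then show "(\<lambda>k. dirichlet c (s + of_real (real k)) - dirichlet c s) \<longlonglongrightarrow> 0 - dirichlet c s"
        by (intro tendsto_diff tendsto_const)
    qed
    then show ?thesis
      unfolding volterra_def h_def[symmetric] by (auto simp: integrable_on_def dest: integral_unique)
  qed
  show ?thesis
    unfolding volterra_graph_def c_def[symmetric]
  proof (intro exI[of _ \<sigma>] allI impI conjI)
    fix s assume s: "\<sigma> < Re s"
    then have "Re s > \<sigma>a" "Re s > \<sigma>b" "Re s > \<sigma>c" unfolding \<sigma>_def by auto
    then have *: "summable (dirichlet_term b s)" "summable (dirichlet_term a s)" "summable (dirichlet_term c s)"
      using \<sigma>a \<sigma>b \<sigma>c summable_norm_cancel by blast+
    then show "summable (dirichlet_term b s)" "summable (dirichlet_term a s)" by auto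
    show "volterra_integrand (dirichlet b) (dirichlet a) s integrable_on {0..}" using main[OF s] by simp
    show "dirichlet_term c s sums volterra (dirichlet b) (dirichlet a) s"
      using main[OF s] *(3) by (simp add: dirichlet_def summable_sums)
  qed
qed

text \<open>The difference of the two series converges to 0 on a half-plane. Hence every coefficient
  sequence in the graph agrees with \<open>volterra_coeff b a\<close> away from index 0, and norms
  may be computed with the latter.\<close>

lemma volterra_graph_unique:
  assumes "volterra_graph b a c" "volterra_graph b a c'" "n \<ge> 1"
  shows "c n = c' n"
proof -
  obtain \<sigma> where \<sigma>: "\<forall>s. Re s > \<sigma> \<longrightarrow> dirichlet_term c s sums volterra (dirichlet b) (dirichlet a) s"
    using assms(1) unfolding volterra_graph_def by blast
  obtain \<sigma>' where \<sigma>': "\<forall>s. Re s > \<sigma>' \<longrightarrow> dirichlet_term c' s sums volterra (dirichlet b) (dirichlet a) s"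
    using assms(2) unfolding volterra_graph_def by blast
  have "dirichlet_term (\<lambda>n. c n - c' n) s sums 0" if "Re s > max \<sigma> \<sigma>'" for s
  proof -
    have "(\<lambda>n. dirichlet_term c s n - dirichlet_term c' s n) sums 0"
      using sums_diff[OF \<sigma>[rule_format, of s] \<sigma>'[rule_format, of s]] that by simp
    then show ?thesis by (simp add: dirichlet_term_def[abs_def] left_diff_distrib)
  qed
  then have "(\<lambda>n. c n - c' n) n = 0" using assms(3) by (rule dirichlet_unique)
  then show ?thesis by simp
qed

section \<open>Norms of Volterra operators\<close>

lemma H2_bounded:
  assumes "a \<in> H2" "n \<ge> 1"
  shows "(cmod (a n))\<^sup>2 \<le> (\<Sum>\<^sub>\<infinity>n\<in>{1..}. (cmod (a n))\<^sup>2)"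
  using finite_sum_le_infsum[of "\<lambda>n. (cmod (a n))\<^sup>2" "{1..}" "{n}"] assms by (simp add: H2_def)

lemma poly_growth_if_square_bounded:
  assumes "\<And>n. n \<ge> 1 \<Longrightarrow> (cmod (a n))\<^sup>2 \<le> K"
  shows "poly_growth a"
proof -
  have "cmod (a n) \<le> sqrt K * real n ^ 0" if "n \<ge> 1" for n
    using assms[OF that] by (simp add: real_le_rsqrt)
  then show ?thesis unfolding poly_growth_def by blast
qed

lemma H2_poly_growth: "a \<in> H2 \<Longrightarrow> poly_growth a"
  by (rule poly_growth_if_square_bounded[OF H2_bounded])

lemma H2_norm_nonneg: "H2_norm a \<ge> 0"
  unfolding H2_norm_def by (simp add: infsum_nonneg)

lemma H2_norm_sq: "(H2_norm a)\<^sup>2 = (\<Sum>\<^sub>\<infinity>n\<in>{1..}. (cmod (a n))\<^sup>2)"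
  unfolding H2_norm_def by (simp add: infsum_nonneg)

lemma H2_norm_cong: "(\<And>n. n \<ge> 1 \<Longrightarrow> a n = b n) \<Longrightarrow> H2_norm a = H2_norm b"
  unfolding H2_norm_def by (intro arg_cong[of _ _ sqrt] infsum_cong) auto

lemma H2_norm_divide:
  assumes "a \<in> H2" "r > 0"
  shows "(\<lambda>n. a n / of_real r) \<in> H2" "H2_norm (\<lambda>n. a n / of_real r) = H2_norm a / r"
proof -
  have eq: "(cmod (a n / of_real r))\<^sup>2 = (cmod (a n))\<^sup>2 * (1 / r\<^sup>2)" for n
    using assms by (simp add: norm_divide power_divide)
  show "(\<lambda>n. a n / of_real r) \<in> H2"
    using assms unfolding H2_def mem_Collect_eq eq by (intro summable_on_cmult_left) auto
  have "H2_norm (\<lambda>n. a n / of_real r) = sqrt ((\<Sum>\<^sub>\<infinity>n\<in>{1..}. (cmod (a n))\<^sup>2) * (1 / r\<^sup>2))"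
    unfolding H2_norm_def eq using assms by (subst infsum_cmult_left) (auto simp: H2_def)
  then show "H2_norm (\<lambda>n. a n / of_real r) = H2_norm a / r"
    using assms by (simp add: H2_norm_def real_sqrt_divide)
qed

lemma volterra_coeff_divide:
  "volterra_coeff b (\<lambda>n. a n / r) N = volterra_coeff b a N / r"
  by (simp add: volterra_coeff_def dconv_def sum_divide_distrib mult.commute)

text \<open>A real supremum bounds its set only if the set is bounded above; this is where
  \<open>volterra_bounded\<close> enters, together with uniqueness of the coefficients. The general
  case follows by normalising \<open>a\<close>.\<close>

lemma volterra_norm_lower:
  assumes b: "volterra_bounded b" "poly_growth b" and a: "a \<in> H2" "H2_norm a > 0"
  shows "H2_norm (volterra_coeff b a) \<le> volterra_norm b * H2_norm a"
proof -
  let ?S = "{H2_norm c | a c. a \<in> H2 \<and> H2_norm a \<le> 1 \<and> volterra_graph b a c}"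
  obtain K where K: "\<And>a. a \<in> H2 \<Longrightarrow> \<exists>c\<in>H2. volterra_graph b a c \<and> H2_norm c \<le> K * H2_norm a"
    using b(1) unfolding volterra_bounded_def by blast
  \<comment> \<open>The absolute value covers a possibly negative K.\<close>
  have "x \<le> \<bar>K\<bar>" if "x \<in> ?S" for x
  proof -
    from that obtain a c where c: "x = H2_norm c" "a \<in> H2" "H2_norm a \<le> 1" "volterra_graph b a c" by blast
    obtain c' where c': "c' \<in> H2" "volterra_graph b a c'" "H2_norm c' \<le> K * H2_norm a" using K[OF c(2)] by blast
    have "H2_norm c = H2_norm c'" using volterra_graph_unique[OF c(4) c'(2)] by (rule H2_norm_cong)
    also have "\<dots> \<le> \<bar>K\<bar> * 1"
      using c'(3) c(3) H2_norm_nonneg[of a] by (meson abs_ge_self abs_ge_zero mult_mono order_trans)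
    finally show ?thesis by (simp add: c)
  qed
  then have bdd: "bdd_above ?S" by (rule bdd_aboveI)
  define r where "r = H2_norm a"
  have r: "r > 0" using a by (simp add: r_def)
  define a' where "a' = (\<lambda>n. a n / of_real r)"
  have a': "a' \<in> H2" "H2_norm a' = 1" using H2_norm_divide[OF a(1) r] r by (auto simp: a'_def r_def)
  have "volterra_graph b a' (volterra_coeff b a')" by (rule volterra_coeff_graph[OF b(2) H2_poly_growth[OF a'(1)]])
  then have *: "H2_norm (volterra_coeff b a') \<le> volterra_norm b"
    unfolding volterra_norm_def using a' by (intro cSup_upper[OF _ bdd]) force
  \<comment> \<open>Scaling the norm of the image by 1 / r requires that
    \<open>volterra_coeff b a\<close> lies in \<open>H2\<close>; boundedness provides some image in
    \<open>H2\<close>, and it has the same coefficients.\<close>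
  obtain c where c: "c \<in> H2" "volterra_graph b a c" using K[OF a(1)] by blast
  have "\<And>n. n \<ge> 1 \<Longrightarrow> volterra_coeff b a n = c n"
    using volterra_graph_unique[OF volterra_coeff_graph[OF b(2) H2_poly_growth[OF a(1)]] c(2)] .
  then have "volterra_coeff b a \<in> H2" using c(1) unfolding H2_def by (auto elim: summable_on_cong[THEN iffD1, rotated])
  moreover have "volterra_coeff b a' = (\<lambda>n. volterra_coeff b a n / of_real r)"
    by (simp add: a'_def volterra_coeff_divide fun_eq_iff)
  ultimately have "H2_norm (volterra_coeff b a') = H2_norm (volterra_coeff b a) / r"
    using H2_norm_divide(2)[OF _ r] by simp
  with * r show ?thesis by (simp add: r_def pos_divide_le_eq)
qed

section \<open>Upper bounds for the norm from a divisor sum\<close>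

text \<open>Weighted Cauchy-Schwarz over the divisors of N in P. The first factor is the divisor sum
  in the hypothesis, whose (ln N)^2 cancels the square of the divisor in
  \<open>volterra_coeff\<close>.\<close>

lemma volterra_coeff_square_le:
  assumes supp: "\<And>n. n \<ge> 1 \<Longrightarrow> b n \<noteq> 0 \<Longrightarrow> n \<in> P" and w: "\<And>n. n \<in> P \<Longrightarrow> w n > 0"
    and C: "\<And>N. N \<ge> 2 \<Longrightarrow> (\<Sum>n | n dvd N \<and> n \<in> P. (ln (real n))\<^sup>2 / w n) \<le> C * (ln (real N))\<^sup>2" "C \<ge> 0"
    and N: "N \<ge> 1"
  shows "(cmod (volterra_coeff b a N))\<^sup>2 \<le>
           C * (\<Sum>n | n dvd N. (if n \<in> P then (cmod (b n))\<^sup>2 * w n else 0) * (cmod (a (N div n)))\<^sup>2)"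
proof (cases "N = 1")
  case True
  have "(\<Sum>n | n dvd N. (if n \<in> P then (cmod (b n))\<^sup>2 * w n else 0) * (cmod (a (N div n)))\<^sup>2) \<ge> 0"
    using w by (intro sum_nonneg) (auto simp: less_imp_le)
  then show ?thesis using True C(2) by (simp add: volterra_coeff_def)
next
  case False
  with N have N: "N \<ge> 2" by simp
  define D where "D = {n. n dvd N \<and> n \<in> P}"
  have fin: "finite {n. n dvd N}" using finite_divisors N by simp
  then have finD: "finite D" unfolding D_def by (rule finite_subset[rotated]) auto
  have D: "n \<ge> 1" "n \<in> P" "n dvd N" if "n \<in> D" for n using that N divisor_bounds[of n N] by (auto simp: D_def)
  have "cmod (dconv (log_coeff b) a N) \<le> (\<Sum>n | n dvd N. cmod (log_coeff b n * a (N div n)))"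
    unfolding dconv_def by (rule norm_sum)
  also have "\<dots> = (\<Sum>n\<in>D. cmod (log_coeff b n * a (N div n)))"
  proof (rule sum.mono_neutral_right[OF fin])
    show "\<forall>i\<in>{n. n dvd N} - D. cmod (log_coeff b i * a (N div i)) = 0"
      using supp divisor_bounds[of _ N] N by (auto simp: D_def log_coeff_def)
  qed (auto simp: D_def)
  \<comment> \<open>Each summand is multiplied and divided by sqrt (w n), so that ln n is separated
    from the coefficients.\<close>
  also have "\<dots> = (\<Sum>n\<in>D. (ln (real n) / sqrt (w n)) * (cmod (b n) * sqrt (w n) * cmod (a (N div n))))"
  proof (rule sum.cong)
    fix n assume "n \<in> D"
    then have "w n > 0" "n \<ge> 1" using w D by auto
    then show "cmod (log_coeff b n * a (N div n)) = (ln (real n) / sqrt (w n)) * (cmod (b n) * sqrt (w n) * cmod (a (N div n)))"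
      by (simp add: log_coeff_def norm_mult)
  qed simp
  finally have "(cmod (dconv (log_coeff b) a N))\<^sup>2 \<le> (\<Sum>n\<in>D. (ln (real n) / sqrt (w n)) * (cmod (b n) * sqrt (w n) * cmod (a (N div n))))\<^sup>2"
    by (rule power_mono) simp
  also have "\<dots> \<le> (\<Sum>n\<in>D. (ln (real n) / sqrt (w n))\<^sup>2) * (\<Sum>n\<in>D. (cmod (b n) * sqrt (w n) * cmod (a (N div n)))\<^sup>2)"
    by (rule Cauchy_Schwarz_ineq_sum)
  also have "(\<Sum>n\<in>D. (ln (real n) / sqrt (w n))\<^sup>2) = (\<Sum>n\<in>D. (ln (real n))\<^sup>2 / w n)"
    using w D by (intro sum.cong) (auto simp: power_divide less_imp_le)
  also have "(\<Sum>n\<in>D. (cmod (b n) * sqrt (w n) * cmod (a (N div n)))\<^sup>2) =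
      (\<Sum>n | n dvd N. (if n \<in> P then (cmod (b n))\<^sup>2 * w n else 0) * (cmod (a (N div n)))\<^sup>2)" (is "_ = ?R")
    using w fin by (intro sum.mono_neutral_cong_left) (auto simp: D_def power_mult_distrib less_imp_le)
  also have "(\<Sum>n\<in>D. (ln (real n))\<^sup>2 / w n) * ?R \<le> (C * (ln (real N))\<^sup>2) * ?R"
    using C(1)[OF N] w by (intro mult_right_mono sum_nonneg) (auto simp: D_def less_imp_le)
  finally have "(cmod (dconv (log_coeff b) a N))\<^sup>2 \<le> C * ?R * (ln (real N))\<^sup>2" by (simp add: mult_ac)
  moreover have "ln (real N) > 0" using N by simp
  ultimately show ?thesis unfolding volterra_coeff_def
    by (simp add: norm_divide power_divide pos_divide_le_eq)
qed

text \<open>Summing the pointwise bound over N gives a double sum that factors into the weighted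
  norm of b and the norm of a. The lower bound w0 on the weight makes b bounded, so that its series
  converges on a half-plane and \<open>volterra_coeff\<close> describes T_g.\<close>

lemma volterra_ineqI:
  assumes w0: "w0 > 0" and w: "\<And>n. n \<ge> 1 \<Longrightarrow> Omega n = m \<Longrightarrow> w n \<ge> w0"
    and C: "\<And>N. N \<ge> 2 \<Longrightarrow> (\<Sum>n | n dvd N \<and> n \<in> {n. n \<ge> 1 \<and> Omega n = m}. (ln (real n))\<^sup>2 / w n) \<le> C * (ln (real N))\<^sup>2" "C > 0"
  shows "volterra_ineq m (\<lambda>n. C * w n)"
  unfolding volterra_ineq_def
proof (intro allI impI)
  fix b
  define P where "P = {n::nat. n \<ge> 1 \<and> Omega n = m}"
  assume "homogeneous m b" and summable: "(\<lambda>n. (cmod (b n))\<^sup>2 * (C * w n)) summable_on {n. n \<ge> 1 \<and> Omega n = m}"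
  then have supp: "\<And>n. n \<ge> 1 \<Longrightarrow> b n \<noteq> 0 \<Longrightarrow> n \<in> P" by (auto simp: homogeneous_def P_def)
  have wpos: "\<And>n. n \<in> P \<Longrightarrow> w n > 0" using w w0 by (force simp: P_def)
  define B where "B = (\<Sum>\<^sub>\<infinity>n\<in>P. (cmod (b n))\<^sup>2 * (C * w n))"
  \<comment> \<open>The weight without C, extended by 0 off P; its sum is B / C, and the factor C of
    the pointwise bound restores B.\<close>
  define \<beta> where "\<beta> = (\<lambda>n. if n \<in> P then (cmod (b n))\<^sup>2 * w n else 0)"
  have sumP: "((\<lambda>n. (cmod (b n))\<^sup>2 * (C * w n)) has_sum B) P"
    using summable unfolding P_def[symmetric] B_def by (rule has_sum_infsum)
  then have "((\<lambda>n. (cmod (b n))\<^sup>2 * (C * w n) * (1 / C)) has_sum (B * (1 / C))) P"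
    by (rule has_sum_cmult_left)
  then have "(\<beta> has_sum (B / C)) P"
    using C(2) by (auto simp: \<beta>_def elim!: has_sum_cong[THEN iffD1, rotated])
  then have \<beta>: "(\<beta> has_sum (B / C)) {1..}"
    by (rule has_sum_cong_neutral[THEN iffD1, rotated -1]) (auto simp: \<beta>_def P_def)
  have \<beta>nonneg: "\<beta> n \<ge> 0" for n using wpos by (auto simp: \<beta>_def less_imp_le)
  have B: "B \<ge> 0" unfolding B_def using wpos C by (intro infsum_nonneg) (auto simp: less_imp_le)
  have growth: "poly_growth b"
  proof (rule poly_growth_if_square_bounded[of _ "B / (C * w0)"])
    fix n :: nat assume n: "n \<ge> 1"
    show "(cmod (b n))\<^sup>2 \<le> B / (C * w0)"
    proof (cases "n \<in> P")
      case True
      have "(cmod (b n))\<^sup>2 * (C * w0) \<le> (cmod (b n))\<^sup>2 * (C * w n)"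
        using True w C by (intro mult_left_mono) (auto simp: P_def)
      also have "\<dots> \<le> B"
        unfolding B_def using finite_sum_le_infsum[of _ P "{n}"] sumP True wpos C
        by (force simp: less_imp_le summable_on_def)
      finally show ?thesis using C w0 by (simp add: pos_le_divide_eq)
    next
      case False
      then have "b n = 0" using supp[OF n] by blast
      then show ?thesis using B C w0 by simp
    qed
  qed
  have main: "volterra_coeff b a \<in> H2 \<and> H2_norm (volterra_coeff b a) \<le> sqrt B * H2_norm a" if a: "a \<in> H2" for a
  proof -
    define A where "A = (\<Sum>\<^sub>\<infinity>n\<in>{1..}. (cmod (a n))\<^sup>2)"
    have A: "((\<lambda>n. (cmod (a n))\<^sup>2) has_sum A) {1..}"
      using a unfolding A_def H2_def by (auto intro: has_sum_infsum)
    have "((\<lambda>(n, k). \<beta> n * (cmod (a k))\<^sup>2) has_sum (B / C * A)) ({1..} \<times> {1..})"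
      using A \<beta> \<beta>nonneg by (intro has_sum_times) (auto simp: summable_on_def)
    then have "((\<lambda>N. \<Sum>n | n dvd N. \<beta> n * (cmod (a (N div n)))\<^sup>2) has_sum (B / C * A)) {1..}"
      by (rule has_sum_divisors)
    from has_sum_cmult_right[OF this, of C]
    have sum: "((\<lambda>N. C * (\<Sum>n | n dvd N. \<beta> n * (cmod (a (N div n)))\<^sup>2)) has_sum (B * A)) {1..}" using C by simp
    have le: "(cmod (volterra_coeff b a N))\<^sup>2 \<le> C * (\<Sum>n | n dvd N. \<beta> n * (cmod (a (N div n)))\<^sup>2)" if "N \<in> {1..}" for N
      unfolding \<beta>_def by (rule volterra_coeff_square_le) (use supp wpos C that in \<open>auto simp: P_def\<close>)
    have "(\<lambda>N. (cmod (volterra_coeff b a N))\<^sup>2) summable_on {1..}"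
      by (rule summable_on_comparison_test[OF _ le]) (use sum in \<open>auto simp: summable_on_def\<close>)
    then have "volterra_coeff b a \<in> H2" "(\<Sum>\<^sub>\<infinity>N\<in>{1..}. (cmod (volterra_coeff b a N))\<^sup>2) \<le> B * A"
      using has_sum_mono[OF has_sum_infsum sum le] by (auto simp: H2_def)
    then show ?thesis unfolding H2_norm_def A_def[symmetric] by (simp flip: real_sqrt_mult)
  qed
  have graph: "volterra_graph b a (volterra_coeff b a)" if "a \<in> H2" for a
    by (rule volterra_coeff_graph[OF growth H2_poly_growth[OF that]])
  have "volterra_bounded b" unfolding volterra_bounded_def
    using main graph by (intro exI[of _ "sqrt B"]) blast
  moreover have "volterra_norm b \<le> sqrt B"
    unfolding volterra_norm_def
  \<comment> \<open>The zero series shows that the supremum is over a nonempty set.\<close>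
  proof (rule cSup_least)
    have "(\<lambda>_. 0) \<in> H2" "H2_norm (\<lambda>_. 0) \<le> 1" by (auto simp: H2_def H2_norm_def)
    then show "{H2_norm c |a c. a \<in> H2 \<and> H2_norm a \<le> 1 \<and> volterra_graph b a c} \<noteq> {}" using graph by blast
    fix x assume "x \<in> {H2_norm c |a c. a \<in> H2 \<and> H2_norm a \<le> 1 \<and> volterra_graph b a c}"
    then obtain a c where c: "x = H2_norm c" "a \<in> H2" "H2_norm a \<le> 1" "volterra_graph b a c" by blast
    have "x = H2_norm (volterra_coeff b a)"
      unfolding c using volterra_graph_unique[OF c(4) graph[OF c(2)]] by (rule H2_norm_cong)
    also have "\<dots> \<le> sqrt B * 1" using main[OF c(2)] c(3) B by (meson mult_left_mono order_trans real_sqrt_ge_zero)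
    finally show "x \<le> sqrt B" by simp
  qed
  ultimately show "volterra_bounded b \<and> volterra_norm b
       \<le> sqrt (\<Sum>\<^sub>\<infinity>n\<in>{n. 1 \<le> n \<and> Omega n = m}. (cmod (b n))\<^sup>2 * (C * w n))"
    by (simp add: B_def P_def)
qed

section \<open>Lower bounds for the norm from finite test functions\<close>

lemma H2_indicator:
  assumes "finite A" "A \<subseteq> {1..}"
  shows "(\<lambda>n. if n \<in> A then 1 else 0) \<in> H2" "(H2_norm (\<lambda>n. if n \<in> A then 1 else 0))\<^sup>2 = card A"
proof -
  have "((\<lambda>n. (cmod (if n \<in> A then 1 else 0))\<^sup>2) has_sum (\<Sum>n\<in>A. 1)) {1..}"
    using assms by (intro has_sum_finite_neutralI[where B = A]) auto
  then show "(\<lambda>n. if n \<in> A then 1 else 0) \<in> H2" "(H2_norm (\<lambda>n. if n \<in> A then 1 else 0))\<^sup>2 = card A"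
    unfolding H2_norm_sq by (auto simp: H2_def summable_on_def infsumI)
qed

text \<open>Test with b and a the indicators of E and A. The last hypothesis says that the image has
  coefficients of modulus at least \<kappa> on G, so \<kappa>^2 |G| is at most the squared norm of
  the image, while the squared norm of a is |A| and that of T_g is at most the sum of w over
  E.\<close>

lemma volterra_ineq_finite:
  assumes ineq: "volterra_ineq m w"
    and E: "finite E" "E \<subseteq> {n. n \<ge> 1 \<and> Omega n = m}" "\<And>n. n \<in> E \<Longrightarrow> w n \<ge> 0"
    and A: "finite A" "A \<subseteq> {1..}" "A \<noteq> {}"
    and G: "finite G" "\<And>N. N \<in> G \<Longrightarrow> N \<ge> 2" "\<kappa> \<ge> 0"
      "\<And>N. N \<in> G \<Longrightarrow> \<kappa> * ln (real N) \<le> (\<Sum>n | n \<in> E \<and> n dvd N \<and> N div n \<in> A. ln (real n))"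
  shows "\<kappa>\<^sup>2 * real (card G) \<le> (\<Sum>n\<in>E. w n) * real (card A)"
proof -
  define b :: "nat \<Rightarrow> complex" where "b = (\<lambda>n. if n \<in> E then 1 else 0)"
  define a :: "nat \<Rightarrow> complex" where "a = (\<lambda>n. if n \<in> A then 1 else 0)"
  define c where "c = volterra_coeff b a"
  define P where "P = {n::nat. n \<ge> 1 \<and> Omega n = m}"
  have hs: "((\<lambda>n. (cmod (b n))\<^sup>2 * w n) has_sum (\<Sum>n\<in>E. w n)) P"
    using E by (intro has_sum_finite_neutralI[where B = E]) (auto simp: b_def P_def)
  have "homogeneous m b" using E by (auto simp: homogeneous_def b_def)
  with ineq hs have bnd: "volterra_bounded b" "volterra_norm b \<le> sqrt (\<Sum>n\<in>E. w n)"
    unfolding volterra_ineq_def P_def by (auto simp: summable_on_def infsumI)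
  have growth: "poly_growth b" "poly_growth a"
    by (auto simp: a_def b_def intro!: poly_growth_if_square_bounded[of _ 1])
  have aH2: "a \<in> H2" "(H2_norm a)\<^sup>2 = card A" unfolding a_def by (rule H2_indicator[OF A(1,2)])+
  have "card A > 0" using A by (simp add: card_gt_0_iff)
  with aH2(2) H2_norm_nonneg[of a] have apos: "H2_norm a > 0" by (cases "H2_norm a = 0") auto
  have "(\<Sum>n\<in>E. w n) \<ge> 0" using E by (intro sum_nonneg) auto
  obtain c' where c': "c' \<in> H2" "volterra_graph b a c'"
    using bnd(1) aH2(1) unfolding volterra_bounded_def by blast
  have "\<And>n. n \<ge> 1 \<Longrightarrow> c' n = c n"
    unfolding c_def using volterra_graph_unique[OF c'(2) volterra_coeff_graph[OF growth]] .
  then have cH2: "c \<in> H2" using c'(1) unfolding H2_def by (auto elim: summable_on_cong[THEN iffD1, rotated])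
  have cN: "\<kappa>\<^sup>2 \<le> (cmod (c N))\<^sup>2" if N: "N \<in> G" for N
  proof -
    have "N \<ge> 2" using G N by auto
    then have ln: "ln (real N) > 0" by simp
    have fin: "finite {n. n dvd N}" using finite_divisors \<open>N \<ge> 2\<close> by simp
    let ?S = "\<Sum>n | n \<in> E \<and> n dvd N \<and> N div n \<in> A. ln (real n)"
    have "dconv (log_coeff b) a N = (\<Sum>n | n \<in> E \<and> n dvd N \<and> N div n \<in> A. of_real (ln (real n)))"
      unfolding dconv_def using fin
      by (intro sum.mono_neutral_cong_right) (auto simp: log_coeff_def b_def a_def)
    then have "c N = of_real (?S / ln (real N))" unfolding c_def volterra_coeff_def by simp
    then have "cmod (c N) = \<bar>?S / ln (real N)\<bar>" by (simp only: norm_of_real)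
    also have "\<dots> \<ge> ?S / ln (real N)" by (rule abs_ge_self)
    finally have "?S / ln (real N) \<le> cmod (c N)" .
    moreover have "\<kappa> \<le> ?S / ln (real N)" using G(4)[OF N] ln by (simp add: pos_le_divide_eq)
    ultimately have "\<kappa> \<le> cmod (c N)" by simp
    then show ?thesis using G(3) by (rule power_mono)
  qed
  have "\<kappa>\<^sup>2 * real (card G) = (\<Sum>N\<in>G. \<kappa>\<^sup>2)" by simp
  also have "\<dots> \<le> (\<Sum>N\<in>G. (cmod (c N))\<^sup>2)" by (rule sum_mono[OF cN])
  also have "\<dots> \<le> (\<Sum>\<^sub>\<infinity>N\<in>{1..}. (cmod (c N))\<^sup>2)"
    using G cH2 by (intro finite_sum_le_infsum) (force simp: H2_def)+
  also have "\<dots> = (H2_norm c)\<^sup>2" by (rule H2_norm_sq[symmetric])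
  also have "\<dots> \<le> (sqrt (\<Sum>n\<in>E. w n) * H2_norm a)\<^sup>2"
  proof (rule power_mono[OF _ H2_norm_nonneg])
    have "H2_norm c \<le> volterra_norm b * H2_norm a"
      unfolding c_def by (rule volterra_norm_lower[OF bnd(1) growth(1) aH2(1) apos])
    also have "\<dots> \<le> sqrt (\<Sum>n\<in>E. w n) * H2_norm a" using bnd(2) apos by (intro mult_right_mono) auto
    finally show "H2_norm c \<le> sqrt (\<Sum>n\<in>E. w n) * H2_norm a" .
  qed
  also have "\<dots> = (\<Sum>n\<in>E. w n) * real (card A)"
    using \<open>(\<Sum>n\<in>E. w n) \<ge> 0\<close> by (simp add: power_mult_distrib aH2)
  finally show ?thesis .
qed

section \<open>Divisors with a given number of prime factors\<close>

lemma Omega_prime_mult: "prime p \<Longrightarrow> n > 0 \<Longrightarrow> Omega (p * n) = Suc (Omega n)"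
  by (simp add: Omega_def prime_factorization_mult prime_factorization_prime)

lemma Omega_eq_0_iff: "n > 0 \<Longrightarrow> Omega n = 0 \<longleftrightarrow> n = 1"
  by (auto simp: Omega_def prime_factorization_empty_iff)

lemma Omega_SucE:
  assumes "n > 0" "Omega n = Suc j"
  obtains P k where "prime P" "n = P * k" "k > 0" "Omega k = j" "\<And>p. p \<in> prime_factors k \<Longrightarrow> p \<le> P"
proof -
  have ne: "prime_factors n \<noteq> {}" using assms by (auto simp: Omega_def)
  define P where "P = Max (prime_factors n)"
  have P: "P \<in> prime_factors n" unfolding P_def by (rule Max_in) (use ne in auto)
  then have pP: "prime P" "P dvd n" by auto
  then obtain k where k: "n = P * k" by blast
  have "k > 0" using k assms by (cases k) auto
  moreover have "Omega k = j" using Omega_prime_mult[OF pP(1) \<open>k > 0\<close>] assms k by simp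
  moreover have "p \<le> P" if "p \<in> prime_factors k" for p
  proof -
    have "p \<in> prime_factors n" using that k assms by (auto simp: in_prime_factors_iff)
    then show ?thesis unfolding P_def by (intro Max_ge) auto
  qed
  ultimately show ?thesis using that pP k by blast
qed

text \<open>Removing the largest prime factor P writes every n on the left as P k. Since h is
  nonnegative, the sum over products is at most the sum over pairs, including pairs whose product
  does not divide N.\<close>

lemma sum_Omega_Suc_le:
  fixes h :: "nat \<Rightarrow> real"
  assumes N: "N > 0" and h: "\<And>n. h n \<ge> 0"
  shows "(\<Sum>n | n dvd N \<and> Omega n = Suc j. h n) \<le>
    (\<Sum>P\<in>prime_factors N. \<Sum>k | k dvd N \<and> Omega k = j \<and> (\<forall>p\<in>prime_factors k. p \<le> P). h (P * k))"
proof -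
  define S where "S = (SIGMA P:prime_factors N. {k. k dvd N \<and> Omega k = j \<and> (\<forall>p\<in>prime_factors k. p \<le> P)})"
  have fin: "finite {k. k dvd N \<and> Omega k = j \<and> (\<forall>p\<in>prime_factors k. p \<le> P)}" for P
    by (rule finite_subset[OF _ finite_divisors_nat[OF N]]) auto
  have finS: "finite S" unfolding S_def using fin by auto
  have "{n. n dvd N \<and> Omega n = Suc j} \<subseteq> (\<lambda>(P, k). P * k) ` S"
  proof
    fix n assume n: "n \<in> {n. n dvd N \<and> Omega n = Suc j}"
    then have "n > 0" using N by (auto intro: dvd_pos_nat)
    then obtain P k where Pk: "prime P" "n = P * k" "k > 0" "Omega k = j" "\<And>p. p \<in> prime_factors k \<Longrightarrow> p \<le> P"
      using Omega_SucE n by blast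
    moreover have "P dvd N" "k dvd N" using n Pk by (auto intro: dvd_trans)
    ultimately have "(P, k) \<in> S" using N by (auto simp: S_def in_prime_factors_iff)
    then show "n \<in> (\<lambda>(P, k). P * k) ` S" using Pk by force
  qed
  then have "(\<Sum>n | n dvd N \<and> Omega n = Suc j. h n) \<le> (\<Sum>n\<in>(\<lambda>(P, k). P * k) ` S. h n)"
    using finS h by (intro sum_mono2) auto
  also have "\<dots> \<le> (\<Sum>x\<in>S. (h \<circ> (\<lambda>(P, k). P * k)) x)"
    using finS h by (intro sum_image_le) auto
  also have "\<dots> = (\<Sum>P\<in>prime_factors N. \<Sum>k | k dvd N \<and> Omega k = j \<and> (\<forall>p\<in>prime_factors k. p \<le> P). h (P * k))"
    unfolding S_def using fin by (subst sum.Sigma) (auto intro!: sum.cong)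
  finally show ?thesis .
qed

text \<open>Every summand on the left occurs when the power on the right is expanded. The induction
  splits off one prime and drops the condition that it be the largest.\<close>

lemma sum_Omega_prod_le:
  fixes \<phi> :: "nat \<Rightarrow> real"
  assumes N: "N > 0" and \<phi>: "\<And>p. \<phi> p \<ge> 0"
  shows "(\<Sum>n | n dvd N \<and> Omega n = j. \<Prod>p\<in>#prime_factorization n. \<phi> p) \<le> (\<Sum>p\<in>prime_factors N. \<phi> p) ^ j"
proof (induction j)
  case 0
  have "n = 1" if "n dvd N" "Omega n = 0" for n
    using that N dvd_pos_nat[of N n] Omega_eq_0_iff[of n] by auto
  then have "{n. n dvd N \<and> Omega n = 0} = {1}" using Omega_eq_0_iff[of 1] by auto
  then show ?case by simp
next
  case (Suc j)
  have prod_nonneg: "(\<Prod>p\<in>#M. \<phi> p) \<ge> 0" for M by (induction M) (auto simp: \<phi>)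
  have fin: "finite {k. k dvd N \<and> Omega k = j}"
    by (rule finite_subset[OF _ finite_divisors_nat[OF N]]) auto
  have "(\<Sum>n | n dvd N \<and> Omega n = Suc j. \<Prod>p\<in>#prime_factorization n. \<phi> p) \<le>
     (\<Sum>P\<in>prime_factors N. \<Sum>k | k dvd N \<and> Omega k = j \<and> (\<forall>p\<in>prime_factors k. p \<le> P). \<Prod>p\<in>#prime_factorization (P * k). \<phi> p)"
    by (rule sum_Omega_Suc_le[OF N prod_nonneg])
  also have "\<dots> = (\<Sum>P\<in>prime_factors N. \<Sum>k | k dvd N \<and> Omega k = j \<and> (\<forall>p\<in>prime_factors k. p \<le> P). \<phi> P * (\<Prod>p\<in>#prime_factorization k. \<phi> p))"
  proof (intro sum.cong refl)
    fix P k assume "P \<in> prime_factors N" "k \<in> {k. k dvd N \<and> Omega k = j \<and> (\<forall>p\<in>prime_factors k. p \<le> P)}"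
    then have "prime P" "P > 0" "k > 0" using N dvd_pos_nat by (auto intro: prime_gt_0_nat)
    then show "(\<Prod>p\<in>#prime_factorization (P * k). \<phi> p) = \<phi> P * (\<Prod>p\<in>#prime_factorization k. \<phi> p)"
      by (simp add: prime_factorization_mult prime_factorization_prime)
  qed
  also have "\<dots> \<le> (\<Sum>P\<in>prime_factors N. \<Sum>k | k dvd N \<and> Omega k = j. \<phi> P * (\<Prod>p\<in>#prime_factorization k. \<phi> p))"
    using fin \<phi> prod_nonneg by (intro sum_mono sum_mono2) auto
  also have "\<dots> = (\<Sum>P\<in>prime_factors N. \<phi> P) * (\<Sum>k | k dvd N \<and> Omega k = j. \<Prod>p\<in>#prime_factorization k. \<phi> p)"
    by (simp add: sum_product)
  also have "\<dots> \<le> (\<Sum>P\<in>prime_factors N. \<phi> P) * (\<Sum>P\<in>prime_factors N. \<phi> P) ^ j"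
    using Suc.IH \<phi> by (intro mult_left_mono sum_nonneg) auto
  finally show ?case by simp
qed

lemma prime_factors_ge_2: "p \<in># prime_factorization N \<Longrightarrow> (p::nat) \<ge> 2"
  by (intro prime_ge_2_nat in_prime_factors_imp_prime)

lemma ln_of_nat_nonneg: "ln (real n) \<ge> 0"
  by (cases n) auto

text \<open>The product of the distinct prime factors of N is at most N.\<close>

lemma sum_ln_prime_factors_le:
  assumes "N > 0" shows "(\<Sum>p\<in>prime_factors N. ln (real p)) \<le> ln (real N)"
proof -
  have "(\<Sum>p\<in>prime_factors N. ln (real p)) = ln (\<Prod>p\<in>prime_factors N. real p)"
    by (rule ln_prod[symmetric]) (auto dest: prime_factors_ge_2)
  also have "\<dots> \<le> ln (real (\<Prod>p\<in>prime_factors N. p ^ multiplicity p N))"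
  proof (subst ln_le_cancel_iff)
    show "(\<Prod>p\<in>prime_factors N. real p) \<le> real (\<Prod>p\<in>prime_factors N. p ^ multiplicity p N)"
      unfolding of_nat_prod of_nat_power
    proof (rule prod_mono, safe)
      fix p assume p: "p \<in># prime_factorization N"
      then have "multiplicity p N \<ge> 1" using assms by (auto simp: in_prime_factors_iff prime_factors_multiplicity)
      then show "real p \<le> real p ^ multiplicity p N"
        using p by (intro self_le_power) (auto dest: prime_factors_ge_2)
    qed simp
  qed (auto intro!: prod_pos dest: prime_factors_ge_2)
  also have "(\<Prod>p\<in>prime_factors N. p ^ multiplicity p N) = N"
    using assms by (simp add: prod_prime_factors)
  finally show ?thesis .
qed

section \<open>Number of distinct prime factors and the divisor sum for m = 2\<close>

lemma card_prime_factors_le: "N > 0 \<Longrightarrow> real (card (prime_factors N)) * ln 2 \<le> ln (real N)"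
proof -
  assume N: "N > 0"
  have "real (card (prime_factors N)) * ln 2 = (\<Sum>p\<in>prime_factors N. ln 2)" by simp
  also have "\<dots> \<le> (\<Sum>p\<in>prime_factors N. ln (real p))"
    by (intro sum_mono) (auto dest: prime_factors_ge_2)
  also have "\<dots> \<le> ln (real N)" by (rule sum_ln_prime_factors_le[OF N])
  finally show ?thesis .
qed

text \<open>With y = ln N, split the prime factors at sqrt y. At most sqrt y are small, and ln y <=
  2 sqrt y; each large one adds at least (ln y) / 2 to a sum bounded by y. Either class contributes
  at most 2 y.\<close>

lemma card_prime_factors_loglog_le:
  assumes N: "N \<ge> 2"
  shows "real (card (prime_factors N)) * loglog (real N) \<le> 4 * ln (real N)"
proof (cases "real N > exp (exp 1)")
  case False
  \<comment> \<open>In the range where \<open>loglog\<close> is 1, the crude bound with ln 2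
    suffices.\<close>
  have "(1/2::real) \<le> ln 2" using ln_le_minus_one[of "1 / 2"] by (simp add: ln_div)
  then have "real (card (prime_factors N)) * (1/2) \<le> real (card (prime_factors N)) * ln 2"
    by (intro mult_left_mono) auto
  also have "\<dots> \<le> ln (real N)" using card_prime_factors_le N by simp
  finally show ?thesis using False N by (simp add: loglog_def)
next
  case True
  define y where "y = ln (real N)"
  have "ln (exp (exp 1)) < y" unfolding y_def using True N by (subst ln_less_cancel_iff) auto
  then have y: "y > exp 1" by simp
  then have y1: "y > 1" by (smt (verit) exp_gt_one)
  define A where "A = {p\<in>prime_factors N. real p \<le> sqrt y}"
  define B where "B = {p\<in>prime_factors N. real p > sqrt y}"
  have AB: "prime_factors N = A \<union> B" "A \<inter> B = {}" "finite A" "finite B" unfolding A_def B_def by auto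
  have cardA: "real (card A) \<le> sqrt y"
  proof -
    have "A \<subseteq> {1..nat \<lfloor>sqrt y\<rfloor>}" unfolding A_def by (auto dest!: prime_factors_ge_2 simp: le_nat_floor)
    then have "card A \<le> card {1..nat \<lfloor>sqrt y\<rfloor>}" by (intro card_mono) auto
    also have "\<dots> = nat \<lfloor>sqrt y\<rfloor>" by simp
    finally show ?thesis using y1 by (smt (verit) of_nat_floor of_nat_mono real_sqrt_ge_zero)
  qed
  have lny: "ln y \<le> 2 * sqrt y"
  proof -
    have "ln y = 2 * ln (sqrt y)" using y1 by (simp add: ln_sqrt)
    also have "ln (sqrt y) \<le> sqrt y" using y1 ln_le_minus_one[of "sqrt y"] by simp
    finally show ?thesis by simp
  qed
  have "real (card B) * (ln y / 2) = (\<Sum>p\<in>B. ln (sqrt y))" using y1 by (simp add: ln_sqrt)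
  also have "\<dots> \<le> (\<Sum>p\<in>B. ln (real p))"
  proof (rule sum_mono)
    fix p assume "p \<in> B"
    then have "sqrt y < real p" by (simp add: B_def)
    moreover have "sqrt y > 0" using y1 by simp
    ultimately show "ln (sqrt y) \<le> ln (real p)" by (intro ln_mono) linarith+
  qed
  also have "\<dots> \<le> (\<Sum>p\<in>prime_factors N. ln (real p))"
    by (intro sum_mono2) (auto simp: B_def dest!: prime_factors_ge_2)
  also have "\<dots> \<le> y" unfolding y_def using N by (intro sum_ln_prime_factors_le) auto
  finally have b: "real (card B) * ln y \<le> 2 * y" by simp
  have "real (card A) * ln y \<le> sqrt y * (2 * sqrt y)" using cardA lny y1 by (intro mult_mono) auto
  also have "\<dots> = 2 * y" using y1 by simp
  finally have "real (card A) * ln y + real (card B) * ln y \<le> 4 * y" using b by simp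
  moreover have "card (prime_factors N) = card A + card B" using AB by (metis card_Un_disjoint)
  ultimately show ?thesis using True by (simp add: loglog_def y_def distrib_right)
qed

lemma loglog_ge_1: "loglog x \<ge> 1"
proof (cases "x > exp (exp 1)")
  case True
  then have "ln (exp (exp 1)) < ln x" by (subst ln_less_cancel_iff) (auto intro: less_trans[OF exp_gt_zero])
  then have "ln (exp 1) < ln (ln x)" by (subst ln_less_cancel_iff) (auto intro: less_trans[OF exp_gt_zero])
  then show ?thesis using True by (simp add: loglog_def)
qed (simp add: loglog_def)

lemma loglog_mono:
  assumes "0 < x" "x \<le> y" shows "loglog x \<le> loglog y"
proof (cases "x > exp (exp 1)")
  case True
  then have "ln (exp (exp 1)) < ln x" by (subst ln_less_cancel_iff) (auto intro: less_trans[OF exp_gt_zero])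
  then have "ln x > 0" by (auto intro: less_trans[OF exp_gt_zero])
  then have "ln (ln x) \<le> ln (ln y)" using assms by (subst ln_le_cancel_iff) auto
  then show ?thesis using True assms by (simp add: loglog_def)
qed (use loglog_ge_1[of y] in \<open>simp add: loglog_def\<close>)

text \<open>k is a product of \<open>Omega k\<close> primes, each at most P.\<close>

lemma ln_le_Omega_mult:
  assumes "k > 0" "P \<ge> 1" "\<And>p. p \<in> prime_factors k \<Longrightarrow> p \<le> P"
  shows "ln (real k) \<le> real (Omega k) * ln (real P)"
proof -
  have "k = (\<Prod>p\<in>#prime_factorization k. p)" using assms by (simp add: prod_mset_prime_factorization_nat)
  also have "\<dots> \<le> P ^ size (prime_factorization k)"
  proof -
    have "(\<Prod>p\<in>#M. p) \<le> P ^ size M" if "\<And>p. p \<in># M \<Longrightarrow> p \<le> P" for M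
      using that by (induction M) (auto intro!: mult_mono)
    then show ?thesis using assms by blast
  qed
  finally have "real k \<le> real P ^ Omega k" unfolding Omega_def by (metis of_nat_le_iff of_nat_power)
  then have "ln (real k) \<le> ln (real P ^ Omega k)" using assms by (subst ln_le_cancel_iff) auto
  then show ?thesis using assms by (simp add: ln_realpow)
qed

text \<open>Write n = P k with k a prime at most P, so ln n <= 2 ln P. The primes k number at most
  \<omega>(N), the values ln P sum to at most ln N, and \<omega>(N) times \<open>loglog\<close> N is
  at most 4 ln N; hence 8 = 2 * 4.\<close>

lemma sum_Omega_2_le:
  assumes N: "N \<ge> 2"
  shows "(\<Sum>n | n dvd N \<and> Omega n = 2. ln (real n) * loglog (real n)) \<le> 8 * (ln (real N))\<^sup>2"
proof -
  let ?L = "loglog (real N)" and ?w = "real (card (prime_factors N))"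
  have N0: "N > 0" using N by simp
  have "(\<Sum>n | n dvd N \<and> Omega n = 2. ln (real n) * loglog (real n)) \<le> (\<Sum>n | n dvd N \<and> Omega n = 2. ln (real n) * ?L)"
  proof (rule sum_mono)
    fix n assume "n \<in> {n. n dvd N \<and> Omega n = 2}"
    then have "n > 0" "n \<le> N" using N dvd_pos_nat[of N n] by (auto intro: dvd_imp_le)
    then show "ln (real n) * loglog (real n) \<le> ln (real n) * ?L" by (intro mult_left_mono loglog_mono) auto
  qed
  also have "\<dots> = ?L * (\<Sum>n | n dvd N \<and> Omega n = Suc 1. ln (real n))"
    by (simp add: sum_distrib_left mult.commute numeral_2_eq_2)
  also have "(\<Sum>n | n dvd N \<and> Omega n = Suc 1. ln (real n)) \<le>
     (\<Sum>P\<in>prime_factors N. \<Sum>k | k dvd N \<and> Omega k = 1 \<and> (\<forall>p\<in>prime_factors k. p \<le> P). ln (real (P * k)))"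
    by (rule sum_Omega_Suc_le[OF N0]) (rule ln_of_nat_nonneg)
  also have "\<dots> \<le> (\<Sum>P\<in>prime_factors N. \<Sum>k | k dvd N \<and> Omega k = 1. 2 * ln (real P))"
  proof (rule sum_mono)
    fix P assume P: "P \<in> prime_factors N"
    then have P1: "P \<ge> 1" by (auto dest: prime_factors_ge_2)
    have "(\<Sum>k | k dvd N \<and> Omega k = 1 \<and> (\<forall>p\<in>prime_factors k. p \<le> P). ln (real (P * k))) \<le>
       (\<Sum>k | k dvd N \<and> Omega k = 1 \<and> (\<forall>p\<in>prime_factors k. p \<le> P). 2 * ln (real P))"
    proof (rule sum_mono)
      fix k assume k: "k \<in> {k. k dvd N \<and> Omega k = 1 \<and> (\<forall>p\<in>prime_factors k. p \<le> P)}"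
      then have "k > 0" using dvd_pos_nat[of N k] N by auto
      with k ln_le_Omega_mult[OF this P1] P1 show "ln (real (P * k)) \<le> 2 * ln (real P)"
        by (simp add: ln_mult)
    qed
    also have "\<dots> \<le> (\<Sum>k | k dvd N \<and> Omega k = 1. 2 * ln (real P))"
      using P1 by (intro sum_mono2 finite_subset[OF _ finite_divisors_nat[OF N0]]) auto
    finally show "(\<Sum>k | k dvd N \<and> Omega k = 1 \<and> (\<forall>p\<in>prime_factors k. p \<le> P). ln (real (P * k))) \<le>
       (\<Sum>k | k dvd N \<and> Omega k = 1. 2 * ln (real P))" .
  qed
  also have "\<dots> = 2 * (real (card {k. k dvd N \<and> Omega k = 1}) * (\<Sum>P\<in>prime_factors N. ln (real P)))"
    by (simp add: sum_distrib_left sum_distrib_right mult_ac)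
  also have "\<dots> \<le> 2 * (?w * ln (real N))"
  proof (intro mult_left_mono mult_mono)
    \<comment> \<open>With weight 1 and j = 1 the product bound counts the prime divisors of
      N.\<close>
    show "real (card {k. k dvd N \<and> Omega k = 1}) \<le> ?w"
      using sum_Omega_prod_le[OF N0, of "\<lambda>_. 1" 1] by simp
    show "(\<Sum>P\<in>prime_factors N. ln (real P)) \<le> ln (real N)" by (rule sum_ln_prime_factors_le[OF N0])
  qed (auto intro!: sum_nonneg ln_of_nat_nonneg)
  finally have "(\<Sum>n | n dvd N \<and> Omega n = 2. ln (real n) * loglog (real n)) \<le> ?L * (2 * (?w * ln (real N)))"
    using loglog_ge_1[of "real N"] by (auto simp: mult_left_mono)
  also have "\<dots> = 2 * (?w * ?L) * ln (real N)" by simp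
  also have "\<dots> \<le> 2 * (4 * ln (real N)) * ln (real N)"
    using card_prime_factors_loglog_le[OF N] N by (intro mult_right_mono mult_left_mono) auto
  finally show ?thesis by (simp add: power2_eq_square)
qed

section \<open>Chebyshev bounds\<close>

text \<open>Chebyshev's argument: all primes in (n, 2n] divide the central binomial coefficient,
  which is at most 4^n.\<close>

lemma sum_ln_primes_dyadic_le:
  "(\<Sum>p | prime p \<and> n < p \<and> p \<le> 2 * n. ln (real p)) \<le> 2 * ln 2 * real n"
proof -
  have "{p. prime p \<and> n < p \<and> p \<le> 2 * n} \<subseteq> prime_factors (2 * n choose n)"
  proof
    fix p assume "p \<in> {p. prime p \<and> n < p \<and> p \<le> 2 * n}"
    then have p: "prime p" "n < p" "p \<le> 2 * n" by auto
    \<comment> \<open>Such a prime divides (2n)! but not n!.\<close>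
    have "p dvd fact n * fact (2 * n - n) * (2 * n choose n)"
      using p binomial_fact_lemma[of n "2 * n"] by (simp add: prime_dvd_fact_iff)
    moreover have "\<not> p dvd fact n" using p by (simp add: prime_dvd_fact_iff)
    ultimately have "p dvd (2 * n choose n)" using p by (auto simp: prime_dvd_mult_iff)
    then show "p \<in> prime_factors (2 * n choose n)" using p by (simp add: in_prime_factors_iff)
  qed
  then have "(\<Sum>p | prime p \<and> n < p \<and> p \<le> 2 * n. ln (real p)) \<le> (\<Sum>p\<in>prime_factors (2 * n choose n). ln (real p))"
    by (intro sum_mono2) (auto simp: ln_of_nat_nonneg)
  also have "\<dots> \<le> ln (real (2 * n choose n))" by (rule sum_ln_prime_factors_le) simp
  also have "\<dots> \<le> ln (real (2 ^ (2 * n)))"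
    using binomial_le_pow2[of "2 * n" n] by (intro ln_mono) (auto simp del: of_nat_power)
  also have "\<dots> = 2 * ln 2 * real n" by (simp add: ln_realpow)
  finally show ?thesis .
qed

text \<open>Partial summation in dyadic form: on (n, 2n] the weight is at most n^(-\<eta>), so the
  block contributes O(n^(1-\<eta>)), and these bounds grow geometrically because \<eta> < 1.\<close>

lemma sum_ln_primes_weighted_le:
  fixes \<eta> :: real
  assumes \<eta>: "0 < \<eta>" "\<eta> < 1"
  obtains C where "C > 0" "\<And>y. y > 0 \<Longrightarrow> (\<Sum>p | prime p \<and> real p \<le> y. ln (real p) * real p powr (- \<eta>)) \<le> C * y powr (1 - \<eta>)"
proof -
  define \<beta> where "\<beta> = 1 - \<eta>"
  \<comment> \<open>Chosen so that C n^\<beta> + 2 ln 2 n^\<beta> = C (2n)^\<beta>, which closes the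
    induction over powers of 2.\<close>
  define C where "C = 2 * ln 2 / (2 powr \<beta> - 1)"
  have \<beta>: "0 < \<beta>" "\<beta> < 1" using \<eta> by (auto simp: \<beta>_def)
  have pos: "2 powr \<beta> - 1 > 0" using \<beta> by simp
  have C: "C > 0" "C * (2 powr \<beta> - 1) = 2 * ln 2" using pos by (auto simp: C_def)
  have fin: "finite {p::nat. prime p \<and> p \<le> n}" for n by (rule finite_subset[of _ "{..n}"]) auto
  have nonneg: "ln (real p) * real p powr (- \<eta>) \<ge> 0" for p by (simp add: ln_of_nat_nonneg)
  have dyadic: "(\<Sum>p | prime p \<and> p \<le> 2 ^ k. ln (real p) * real p powr (- \<eta>)) \<le> C * (2 ^ k) powr \<beta>" for k :: nat
  proof (induction k)
    case 0
    have "\<not> (prime p \<and> p \<le> 2 ^ 0)" for p :: nat using prime_ge_2_nat[of p] by auto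
    then have "{p::nat. prime p \<and> p \<le> 2 ^ 0} = {}" by blast
    then show ?case using C by (simp only: sum.empty) simp
  next
    case (Suc k)
    define n where "n = (2 ^ k :: nat)"
    have n: "n > 0" "2 ^ Suc k = 2 * n" "real n = 2 ^ k" by (auto simp: n_def)
    have split: "{p. prime p \<and> p \<le> 2 * n} = {p. prime p \<and> p \<le> n} \<union> {p. prime p \<and> n < p \<and> p \<le> 2 * n}" by auto
    have "(\<Sum>p | prime p \<and> p \<le> 2 * n. ln (real p) * real p powr (- \<eta>)) =
      (\<Sum>p | prime p \<and> p \<le> n. ln (real p) * real p powr (- \<eta>)) +
      (\<Sum>p | prime p \<and> n < p \<and> p \<le> 2 * n. ln (real p) * real p powr (- \<eta>))"
      unfolding split by (rule sum.union_disjoint) (auto intro: finite_subset[OF _ fin[of "2 * n"]])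
    also have "\<dots> \<le> C * real n powr \<beta> + C * (2 powr \<beta> - 1) * real n powr \<beta>"
    proof (rule add_mono)
      show "(\<Sum>p | prime p \<and> p \<le> n. ln (real p) * real p powr (- \<eta>)) \<le> C * real n powr \<beta>"
        using Suc.IH by (simp add: n_def)
      have "(\<Sum>p | prime p \<and> n < p \<and> p \<le> 2 * n. ln (real p) * real p powr (- \<eta>)) \<le>
          (\<Sum>p | prime p \<and> n < p \<and> p \<le> 2 * n. ln (real p) * real n powr (- \<eta>))"
        using \<eta> n by (intro sum_mono mult_left_mono powr_mono2') (auto simp: ln_of_nat_nonneg)
      also have "\<dots> \<le> (2 * ln 2 * real n) * real n powr (- \<eta>)"
        unfolding sum_distrib_right[symmetric] by (intro mult_right_mono sum_ln_primes_dyadic_le) auto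
      also have "\<dots> = 2 * ln 2 * (real n * real n powr (- \<eta>))" by simp
      also have "real n * real n powr (- \<eta>) = real n powr \<beta>"
        using n(1) unfolding \<beta>_def by (simp add: powr_diff powr_minus divide_inverse)
      finally show "(\<Sum>p | prime p \<and> n < p \<and> p \<le> 2 * n. ln (real p) * real p powr (- \<eta>)) \<le>
          C * (2 powr \<beta> - 1) * real n powr \<beta>"
        unfolding C(2) .
    qed
    also have "\<dots> = C * (2 * real n) powr \<beta>"
      by (simp add: powr_mult algebra_simps)
    finally show ?case using n by simp
  qed
  show ?thesis
  \<comment> \<open>The extra factor comes from rounding y up to a power of 2 that is at most 2
    y.\<close>
  proof (rule that[of "C * 2 powr \<beta>"])
    show "C * 2 powr \<beta> > 0" using C by simp
    fix y :: real assume y: "y > 0"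
    show "(\<Sum>p | prime p \<and> real p \<le> y. ln (real p) * real p powr (- \<eta>)) \<le> C * 2 powr \<beta> * y powr (1 - \<eta>)"
    proof (cases "y < 1")
      case True
      have "\<not> (prime p \<and> real p \<le> y)" for p using prime_ge_2_nat[of p] True by auto
      then have "{p::nat. prime p \<and> real p \<le> y} = {}" by blast
      then show ?thesis using C by (simp only: sum.empty) simp
    next
      case False
      then have y: "y \<ge> 1" by simp
      define k where "k = nat \<lceil>log 2 y\<rceil>"
      have "log 2 y \<ge> 0" using y by simp
      then have k: "log 2 y \<le> real k" "real k \<le> log 2 y + 1" unfolding k_def by linarith+
      have "y = 2 powr (log 2 y)" using y by simp
      also have "\<dots> \<le> 2 powr real k" using k by (intro powr_mono) auto
      finally have 1: "y \<le> 2 ^ k" by (simp add: powr_realpow)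
      have "2 powr real k \<le> 2 powr (log 2 y + 1)" using k by (intro powr_mono) auto
      also have "\<dots> = 2 * y" using y by (simp add: powr_add)
      finally have 2: "2 ^ k \<le> 2 * y" by (simp add: powr_realpow)
      have "p \<le> 2 ^ k" if "real p \<le> y" for p :: nat
      proof -
        have "real p \<le> real (2 ^ k)" using order_trans[OF that 1] by (simp only: of_nat_power of_nat_numeral)
        then show ?thesis by (simp only: of_nat_le_iff)
      qed
      then have "(\<Sum>p | prime p \<and> real p \<le> y. ln (real p) * real p powr (- \<eta>)) \<le>
          (\<Sum>p | prime p \<and> p \<le> 2 ^ k. ln (real p) * real p powr (- \<eta>))"
        using fin nonneg by (intro sum_mono2) auto
      also have "\<dots> \<le> C * (2 ^ k) powr \<beta>" by (rule dyadic)
      also have "\<dots> \<le> C * (2 * y) powr \<beta>" using C \<beta> 2 by (intro mult_left_mono powr_mono2) auto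
      also have "\<dots> = C * 2 powr \<beta> * y powr \<beta>" using y by (simp add: powr_mult)
      finally show ?thesis by (simp add: \<beta>_def)
    qed
  qed
qed

text \<open>Split the prime factors at y = ln N. Those up to y are handled by the sum over all
  primes up to y; for the others p^(-\<eta>) <= y^(-\<eta>), and their logarithms sum to at most
  y.\<close>

lemma sum_prime_factors_weighted_le:
  fixes \<eta> :: real
  assumes \<eta>: "0 < \<eta>" "\<eta> < 1"
  obtains C where "C > 0" "\<And>N. N \<ge> 2 \<Longrightarrow> (\<Sum>p\<in>prime_factors N. ln (real p) * real p powr (- \<eta>)) \<le> C * ln (real N) powr (1 - \<eta>)"
proof -
  obtain C where C: "C > 0" "\<And>y. y > 0 \<Longrightarrow> (\<Sum>p | prime p \<and> real p \<le> y. ln (real p) * real p powr (- \<eta>)) \<le> C * y powr (1 - \<eta>)"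
    using sum_ln_primes_weighted_le[OF \<eta>] by metis
  show ?thesis
  proof (rule that[of "C + 1"])
    fix N :: nat assume N: "N \<ge> 2"
    define y where "y = ln (real N)"
    have y: "y > 0" using N by (simp add: y_def)
    define A where "A = {p\<in>prime_factors N. real p \<le> y}"
    define B where "B = {p\<in>prime_factors N. real p > y}"
    have AB: "prime_factors N = A \<union> B" by (auto simp: A_def B_def)
    have "(\<Sum>p\<in>prime_factors N. ln (real p) * real p powr (- \<eta>)) =
        (\<Sum>p\<in>A. ln (real p) * real p powr (- \<eta>)) + (\<Sum>p\<in>B. ln (real p) * real p powr (- \<eta>))"
      unfolding AB by (rule sum.union_disjoint) (auto simp: A_def B_def)
    moreover have "(\<Sum>p\<in>A. ln (real p) * real p powr (- \<eta>)) \<le> C * y powr (1 - \<eta>)"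
    proof -
      have "(\<Sum>p\<in>A. ln (real p) * real p powr (- \<eta>)) \<le> (\<Sum>p | prime p \<and> real p \<le> y. ln (real p) * real p powr (- \<eta>))"
      proof (rule sum_mono2)
        have "{p. prime p \<and> real p \<le> y} \<subseteq> {..nat \<lfloor>y\<rfloor>}" using y by (auto simp: le_nat_floor)
        then show "finite {p. prime p \<and> real p \<le> y}" by (rule finite_subset) simp
      qed (auto simp: A_def ln_of_nat_nonneg)
      also have "\<dots> \<le> C * y powr (1 - \<eta>)" by (rule C(2)[OF y])
      finally show ?thesis .
    qed
    moreover have "(\<Sum>p\<in>B. ln (real p) * real p powr (- \<eta>)) \<le> y powr (1 - \<eta>)"
    proof -
      have "(\<Sum>p\<in>B. ln (real p) * real p powr (- \<eta>)) \<le> (\<Sum>p\<in>B. ln (real p) * y powr (- \<eta>))"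
        using y \<eta> by (intro sum_mono mult_left_mono powr_mono2') (auto simp: B_def ln_of_nat_nonneg)
      also have "\<dots> \<le> (\<Sum>p\<in>prime_factors N. ln (real p) * y powr (- \<eta>))"
        by (rule sum_mono2) (auto simp: B_def ln_of_nat_nonneg)
      also have "\<dots> \<le> y * y powr (- \<eta>)"
        unfolding sum_distrib_right[symmetric] using N sum_ln_prime_factors_le[of N]
        by (intro mult_right_mono) (auto simp: y_def)
      also have "\<dots> = y powr (1 - \<eta>)" using y by (simp add: powr_diff powr_minus divide_inverse)
      finally show ?thesis .
    qed
    ultimately show "(\<Sum>p\<in>prime_factors N. ln (real p) * real p powr (- \<eta>)) \<le> (C + 1) * ln (real N) powr (1 - \<eta>)"
      by (simp add: y_def distrib_right)
  qed (use C in simp)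
qed

section \<open>The divisor sum for m >= 3\<close>

text \<open>Put P = p q. Then ln P = ln p + ln q, where ln q <= q^\<delta> / \<delta>, and ln p >=
  ln 2 lets the second summand be absorbed into a multiple of ln p q^\<delta>. A constant is
  unavoidable, as (ln x) x^(-\<delta>) increases up to exp (1 / \<delta>).\<close>

lemma ln_mult_powr_almost_antimono:
  fixes p P \<delta> :: real
  assumes "\<delta> > 0" "2 \<le> p" "p \<le> P"
  shows "ln P * P powr (- \<delta>) \<le> (1 + 1 / (\<delta> * ln 2)) * (ln p * p powr (- \<delta>))"
proof -
  define q where "q = P / p"
  have q: "q \<ge> 1" "P = p * q" using assms by (auto simp: q_def)
  have lnp: "ln 2 \<le> ln p" using assms by simp
  have q1: "q powr \<delta> \<ge> 1" using q assms by (simp add: ge_one_powr_ge_zero)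
  have "ln P = ln p + ln q" using q assms by (simp add: ln_mult)
  moreover have "ln q \<le> q powr \<delta> / \<delta>" by (rule ln_powr_bound) (use q assms in auto)
  moreover have "q powr \<delta> / \<delta> \<le> (q powr \<delta> / \<delta>) * (ln p / ln 2)"
    using mult_left_mono[of 1 "ln p / ln 2" "q powr \<delta> / \<delta>"] assms lnp by simp
  moreover have "ln p \<le> ln p * q powr \<delta>" using mult_left_mono[OF q1, of "ln p"] assms by simp
  moreover have "ln p * q powr \<delta> + (q powr \<delta> / \<delta>) * (ln p / ln 2) = (1 + 1 / (\<delta> * ln 2)) * (ln p * q powr \<delta>)"
    by (simp add: algebra_simps)
  ultimately have "ln P \<le> (1 + 1 / (\<delta> * ln 2)) * (ln p * q powr \<delta>)" by linarith
  then have "ln P * P powr (- \<delta>) \<le> (1 + 1 / (\<delta> * ln 2)) * (ln p * q powr \<delta>) * P powr (- \<delta>)"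
    by (rule mult_right_mono) simp
  also have "\<dots> = (1 + 1 / (\<delta> * ln 2)) * (ln p * p powr (- \<delta>))"
    using q assms by (simp add: powr_mult powr_minus field_simps)
  finally show ?thesis .
qed

lemma powr_prod_mset:
  fixes M :: "nat multiset" shows "real (\<Prod>\<^sub># M) powr a = (\<Prod>p\<in>#M. real p powr a)"
  by (induction M) (auto simp: powr_mult)

text \<open>Each prime p in M trades one factor (ln P) P^(-\<delta>) for the same expression at
  p.\<close>

lemma prod_mset_weight_le:
  fixes \<alpha> \<delta> P :: real and M :: "nat multiset"
  assumes \<delta>: "\<delta> > 0" and M: "\<And>p. p \<in># M \<Longrightarrow> 2 \<le> p \<and> real p \<le> P"
  shows "(ln P * P powr (- \<delta>)) ^ size M * (\<Prod>p\<in>#M. real p powr (- \<alpha>)) \<le>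
     (1 + 1 / (\<delta> * ln 2)) ^ size M * (\<Prod>p\<in>#M. ln (real p) * real p powr (- (\<alpha> + \<delta>)))"
  using M
proof (induction M)
  case (add p M)
  let ?K = "1 + 1 / (\<delta> * ln 2)"
  have p: "2 \<le> real p" "real p \<le> P" using add.prems[of p] by auto
  have K: "?K \<ge> 0" using \<delta> by simp
  have IH: "(ln P * P powr (- \<delta>)) ^ size M * (\<Prod>p\<in>#M. real p powr (- \<alpha>)) \<le>
     ?K ^ size M * (\<Prod>p\<in>#M. ln (real p) * real p powr (- (\<alpha> + \<delta>)))"
    using add.prems by (intro add.IH) auto
  have nnP: "ln P \<ge> 0" using p by simp
  have nn1: "(\<Prod>p\<in>#M. real p powr (- \<alpha>)) \<ge> 0" by (induction M) auto
  have "(ln P * P powr (- \<delta>)) * real p powr (- \<alpha>) \<le> ?K * (ln (real p) * real p powr (- \<delta>)) * real p powr (- \<alpha>)"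
    by (intro mult_right_mono ln_mult_powr_almost_antimono[OF \<delta> p]) auto
  also have "\<dots> = ?K * (ln (real p) * real p powr (- (\<alpha> + \<delta>)))" by (simp add: powr_diff powr_minus powr_add divide_inverse)
  finally have "((ln P * P powr (- \<delta>)) * real p powr (- \<alpha>)) * ((ln P * P powr (- \<delta>)) ^ size M * (\<Prod>p\<in>#M. real p powr (- \<alpha>))) \<le>
     (?K * (ln (real p) * real p powr (- (\<alpha> + \<delta>)))) * (?K ^ size M * (\<Prod>p\<in>#M. ln (real p) * real p powr (- (\<alpha> + \<delta>))))"
    by (rule mult_mono[OF _ IH])
      (intro mult_nonneg_nonneg zero_le_power K nn1 nnP ln_of_nat_nonneg powr_ge_zero)+
  then show ?case by (simp add: mult_ac)
qed simp

lemma sum_Omega_weighted_le: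
  assumes m: "m \<ge> 3"
  obtains C where "C > 0" "\<And>N. N \<ge> 2 \<Longrightarrow>
    (\<Sum>n | n dvd N \<and> Omega n = m. ln (real n) ^ m * real n powr (- ((real m - 2) / real m))) \<le> C * (ln (real N))\<^sup>2"
proof -
  \<comment> \<open>\<alpha> is the exponent of the weight. Since (m - 1) \<delta> = \<alpha>,
    P^(-\<alpha>) splits into m - 1 equal factors, one for each prime of the cofactor; the resulting
    exponent \<alpha> + \<delta> = (m - 2) / (m - 1) is below 1.\<close>
  define \<alpha> \<delta> where "\<alpha> = (real m - 2) / real m" and "\<delta> = \<alpha> / (real m - 1)"
  have \<alpha>: "\<alpha> > 0" using m by (simp add: \<alpha>_def)
  have \<delta>: "\<delta> > 0" using m \<alpha> by (simp add: \<delta>_def)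
  have sum: "\<alpha> + \<delta> = (real m - 2) / (real m - 1)"
    using m by (simp add: \<alpha>_def \<delta>_def divide_simps) (simp add: algebra_simps)
  have \<eta>: "0 < \<alpha> + \<delta>" "\<alpha> + \<delta> < 1" using m \<alpha> \<delta> unfolding sum by auto
  define K where "K = 1 + 1 / (\<delta> * ln 2)"
  have K: "K > 0" using \<delta> by (simp add: K_def add_pos_pos)
  define \<phi> where "\<phi> = (\<lambda>p. ln (real p) * real p powr (- (\<alpha> + \<delta>)))"
  have \<phi>: "\<phi> p \<ge> 0" for p by (simp add: \<phi>_def ln_of_nat_nonneg)
  have prod_nonneg: "(\<Prod>p\<in>#M. \<phi> p) \<ge> 0" for M by (induction M) (auto simp: \<phi>)
  obtain D where D: "D > 0" "\<And>N. N \<ge> 2 \<Longrightarrow> (\<Sum>p\<in>prime_factors N. \<phi> p) \<le> D * ln (real N) powr (1 - (\<alpha> + \<delta>))"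
    using sum_prime_factors_weighted_le[OF \<eta>] unfolding \<phi>_def by metis
  define h where "h = (\<lambda>n. ln (real n) ^ m * real n powr (- \<alpha>))"
  have h: "h n \<ge> 0" for n by (simp add: h_def ln_of_nat_nonneg)
  have sm: "Suc (m - 1) = m" using m by simp
  \<comment> \<open>With P the largest prime, ln n <= m ln P. One factor ln P is kept, to be summed
    over P; the other m - 1 go to the primes of k together with P^(-\<alpha>).\<close>
  have term_le: "h (P * k) \<le> real m ^ m * K ^ (m - 1) * (ln (real P) * (\<Prod>p\<in>#prime_factorization k. \<phi> p))"
    if "P \<ge> 2" "k > 0" "Omega k = m - 1" "\<forall>p\<in>prime_factors k. p \<le> P" for P k
  proof -
    have "ln (real (P * k)) = ln (real P) + ln (real k)" using that by (simp add: ln_mult)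
    moreover have "ln (real k) \<le> real (Omega k) * ln (real P)" using that by (intro ln_le_Omega_mult) auto
    moreover have "ln (real P) + real (Omega k) * ln (real P) = real m * ln (real P)"
      using that m by (simp add: of_nat_diff algebra_simps)
    ultimately have "ln (real (P * k)) \<le> real m * ln (real P)" by linarith
    then have "ln (real (P * k)) ^ m \<le> (real m * ln (real P)) ^ m"
      by (rule power_mono) (rule ln_of_nat_nonneg)
    also have "\<dots> = real m ^ m * (ln (real P) * ln (real P) ^ (m - 1))"
      using sm by (metis power_Suc power_mult_distrib)
    finally have 1: "ln (real (P * k)) ^ m \<le> real m ^ m * (ln (real P) * ln (real P) ^ (m - 1))" .
    have "real (P * k) powr (- \<alpha>) = real P powr (- \<alpha>) * real k powr (- \<alpha>)"
      by (simp add: powr_mult)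
    also have "real P powr (- \<alpha>) = (real P powr (- \<delta>)) ^ (m - 1)"
      using that m by (simp add: powr_power \<delta>_def of_nat_diff)
    also have "real k powr (- \<alpha>) = (\<Prod>p\<in>#prime_factorization k. real p powr (- \<alpha>))"
      using that powr_prod_mset[of "prime_factorization k"] by (simp add: prod_mset_prime_factorization_nat)
    finally have 2: "real (P * k) powr (- \<alpha>) = (real P powr (- \<delta>)) ^ (m - 1) * (\<Prod>p\<in>#prime_factorization k. real p powr (- \<alpha>))" .
    have "h (P * k) \<le> real m ^ m * (ln (real P) * ln (real P) ^ (m - 1)) * real (P * k) powr (- \<alpha>)"
      unfolding h_def by (rule mult_right_mono[OF 1]) simp
    also have "\<dots> = real m ^ m * ln (real P) * ((ln (real P) * real P powr (- \<delta>)) ^ (m - 1) * (\<Prod>p\<in>#prime_factorization k. real p powr (- \<alpha>)))"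
      unfolding 2 by (simp add: power_mult_distrib mult_ac)
    also have "\<dots> \<le> real m ^ m * ln (real P) * (K ^ (m - 1) * (\<Prod>p\<in>#prime_factorization k. \<phi> p))"
    proof (rule mult_left_mono)
      have "size (prime_factorization k) = m - 1" using that by (simp add: Omega_def)
      then show "(ln (real P) * real P powr (- \<delta>)) ^ (m - 1) * (\<Prod>p\<in>#prime_factorization k. real p powr (- \<alpha>)) \<le>
          K ^ (m - 1) * (\<Prod>p\<in>#prime_factorization k. \<phi> p)"
        using prod_mset_weight_le[OF \<delta>, of "prime_factorization k" "real P" \<alpha>] that prime_factors_ge_2
        unfolding K_def \<phi>_def by fastforce
    qed (simp add: ln_of_nat_nonneg)
    finally show ?thesis by (simp add: mult_ac)
  qed
  show ?thesis
  proof (rule that[of "real m ^ m * K ^ (m - 1) * D ^ (m - 1)"])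
    show "real m ^ m * K ^ (m - 1) * D ^ (m - 1) > 0" using m K D by simp
    fix N :: nat assume N: "N \<ge> 2"
    then have N0: "N > 0" by simp
    let ?y = "ln (real N)" and ?c = "real m ^ m * K ^ (m - 1)"
    have y: "?y > 0" using N by simp
    have "(\<Sum>n | n dvd N \<and> Omega n = m. h n) = (\<Sum>n | n dvd N \<and> Omega n = Suc (m - 1). h n)" using sm by simp
    also have "\<dots> \<le> (\<Sum>P\<in>prime_factors N. \<Sum>k | k dvd N \<and> Omega k = m - 1 \<and> (\<forall>p\<in>prime_factors k. p \<le> P). h (P * k))"
      by (rule sum_Omega_Suc_le[OF N0 h])
    also have "\<dots> \<le> (\<Sum>P\<in>prime_factors N. \<Sum>k | k dvd N \<and> Omega k = m - 1 \<and> (\<forall>p\<in>prime_factors k. p \<le> P).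
        ?c * (ln (real P) * (\<Prod>p\<in>#prime_factorization k. \<phi> p)))"
    proof (intro sum_mono term_le)
      fix P k assume "P \<in> prime_factors N" "k \<in> {k. k dvd N \<and> Omega k = m - 1 \<and> (\<forall>p\<in>prime_factors k. p \<le> P)}"
      then show "P \<ge> 2" "k > 0" "Omega k = m - 1" "\<forall>p\<in>prime_factors k. p \<le> P"
        using prime_factors_ge_2 dvd_pos_nat[OF N0] by auto
    qed
    also have "\<dots> \<le> (\<Sum>P\<in>prime_factors N. \<Sum>k | k dvd N \<and> Omega k = m - 1.
        ?c * (ln (real P) * (\<Prod>p\<in>#prime_factorization k. \<phi> p)))"
      using K prod_nonneg
      by (intro sum_mono sum_mono2 finite_subset[OF _ finite_divisors_nat[OF N0]]) (auto simp: ln_of_nat_nonneg)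
    also have "\<dots> = ?c * ((\<Sum>P\<in>prime_factors N. ln (real P)) * (\<Sum>k | k dvd N \<and> Omega k = m - 1. \<Prod>p\<in>#prime_factorization k. \<phi> p))"
      unfolding sum_product by (simp add: sum_distrib_left)
    also have "\<dots> \<le> ?c * (?y * (\<Sum>p\<in>prime_factors N. \<phi> p) ^ (m - 1))"
      using K y prod_nonneg
      by (intro mult_left_mono mult_mono sum_ln_prime_factors_le sum_Omega_prod_le N0 \<phi> sum_nonneg) auto
    also have "\<dots> \<le> ?c * (?y * (D * ?y powr (1 - (\<alpha> + \<delta>))) ^ (m - 1))"
      using K y by (intro mult_left_mono power_mono D N sum_nonneg \<phi>) auto
    \<comment> \<open>The exponent 1 - (\<alpha> + \<delta>) is 1 / (m - 1), so the power gives
      exactly one more factor ln N.\<close>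
    also have "(D * ?y powr (1 - (\<alpha> + \<delta>))) ^ (m - 1) = D ^ (m - 1) * ?y"
    proof -
      have "(1 - (\<alpha> + \<delta>)) * real (m - 1) = 1" unfolding sum using m by (simp add: of_nat_diff field_simps)
      moreover have "(?y powr (1 - (\<alpha> + \<delta>))) ^ (m - 1) = ?y powr ((1 - (\<alpha> + \<delta>)) * real (m - 1))"
        using y by (subst powr_realpow[symmetric]) (simp_all add: powr_powr)
      ultimately have "(?y powr (1 - (\<alpha> + \<delta>))) ^ (m - 1) = ?y" using y by (simp only: powr_one)
      then show ?thesis by (simp only: power_mult_distrib)
    qed
    finally show "(\<Sum>n | n dvd N \<and> Omega n = m. ln (real n) ^ m * real n powr (- ((real m - 2) / real m))) \<le> ?c * D ^ (m - 1) * ?y\<^sup>2"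
      by (simp add: h_def \<alpha>_def power2_eq_square mult_ac)
  qed
qed

section \<open>Lower bound for the number of primes\<close>

text \<open>Legendre's formula cut off at K, beyond which the quotients vanish. In the step from n
  to n + 1 the multiplicity of p in n + 1 counts the i with p^i dividing n + 1.\<close>

lemma multiplicity_fact_Legendre:
  assumes "prime p" "n < p ^ Suc K"
  shows "multiplicity p (fact n :: nat) = (\<Sum>i\<in>{1..K}. n div p ^ i)"
  using assms(2)
proof (induction n)
  case (Suc n)
  have p: "prime_elem p" "\<not> is_unit p" using assms(1) by (auto dest: not_prime_unit)
  define \<mu> where "\<mu> = multiplicity p (Suc n)"
  have dvd_iff: "p ^ i dvd Suc n \<longleftrightarrow> i \<le> \<mu>" for i
    unfolding \<mu>_def using p by (intro power_dvd_iff_le_multiplicity) auto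
  have "\<mu> \<le> K"
  proof (rule ccontr)
    assume "\<not> \<mu> \<le> K"
    then have "p ^ Suc K dvd Suc n" using dvd_iff[of "Suc K"] by simp
    then have "p ^ Suc K \<le> Suc n" by (rule dvd_imp_le) simp
    with Suc.prems show False by simp
  qed
  have "multiplicity p (fact (Suc n) :: nat) = multiplicity p (Suc n) + multiplicity p (fact n :: nat)"
    using p by (simp only: fact_Suc of_nat_id) (rule prime_elem_multiplicity_mult_distrib, auto)
  also have "\<dots> = \<mu> + (\<Sum>i\<in>{1..K}. n div p ^ i)" using Suc by (simp add: \<mu>_def)
  also have "\<mu> = (\<Sum>i\<in>{1..K}. if i \<le> \<mu> then 1 else 0)"
  proof -
    have "(\<Sum>i\<in>{1..K}. if i \<le> \<mu> then 1 else 0) = card ({1..K} \<inter> {i. i \<le> \<mu>})"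
      by (simp add: sum.If_cases)
    also have "{1..K} \<inter> {i. i \<le> \<mu>} = {1..\<mu>}" using \<open>\<mu> \<le> K\<close> by auto
    finally show ?thesis by simp
  qed
  \<comment> \<open>Passing from n to n + 1 raises the quotient by p^i exactly when p^i divides n +
    1.\<close>
  also have "(\<Sum>i\<in>{1..K}. if i \<le> \<mu> then 1 else 0) + (\<Sum>i\<in>{1..K}. n div p ^ i) = (\<Sum>i\<in>{1..K}. Suc n div p ^ i)"
    unfolding sum.distrib[symmetric] dvd_iff[symmetric]
    by (intro sum.cong refl) (auto simp: div_Suc dvd_eq_mod_eq_0)
  finally show ?case .
qed simp

text \<open>By Legendre's formula the multiplicity is a sum of floor (2 x) - 2 floor x, each at most
  1, over the K exponents i >= 1 with p^i <= 2n.\<close>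

lemma prime_power_central_binomial_le:
  assumes p: "prime p" and n: "n > 0"
  shows "p ^ multiplicity p (2 * n choose n) \<le> 2 * n"
proof -
  have p2: "p \<ge> 2" using p by (rule prime_ge_2_nat)
  obtain K where K: "p ^ K \<le> 2 * n" "2 * n < p ^ Suc K"
    using ex_power_ivl1[of p "2 * n"] p2 n by auto
  let ?m = "multiplicity p (2 * n choose n)"
  have "fact (2 * n) = (fact n * fact n :: nat) * (2 * n choose n)"
    using binomial_fact_lemma[of n "2 * n"] by (simp add: mult_2)
  then have "multiplicity p (fact (2 * n) :: nat) = multiplicity p (fact n :: nat) + multiplicity p (fact n :: nat) + ?m"
    using p by (simp add: prime_elem_multiplicity_mult_distrib)
  then have "(\<Sum>i\<in>{1..K}. 2 * n div p ^ i) = 2 * (\<Sum>i\<in>{1..K}. n div p ^ i) + ?m"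
    using multiplicity_fact_Legendre[OF p, of "2 * n" K] multiplicity_fact_Legendre[OF p, of n K] K by simp
  moreover have "(\<Sum>i\<in>{1..K}. 2 * n div p ^ i) \<le> (\<Sum>i\<in>{1..K}. 2 * (n div p ^ i) + 1)"
  proof (rule sum_mono)
    fix i
    have "p ^ i > 0" using p2 by simp
    then have "n < (n div p ^ i) * p ^ i + p ^ i" by (metis div_mult_mod_eq mod_less_divisor nat_add_left_cancel_less)
    then have "2 * n < (2 * (n div p ^ i) + 2) * p ^ i" by (simp add: algebra_simps)
    then have "2 * n div p ^ i < 2 * (n div p ^ i) + 2" using \<open>p ^ i > 0\<close> by (simp add: less_mult_imp_div_less)
    then show "2 * n div p ^ i \<le> 2 * (n div p ^ i) + 1" by simp
  qed
  moreover have "(\<Sum>i\<in>{1..K}. 2 * (n div p ^ i) + 1) = 2 * (\<Sum>i\<in>{1..K}. n div p ^ i) + K"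
    by (simp only: sum.distrib sum_distrib_left[symmetric]) simp
  ultimately have "?m \<le> K" by linarith
  then have "p ^ ?m \<le> p ^ K" using p2 by (intro power_increasing) auto
  with K show ?thesis by linarith
qed

text \<open>The central binomial coefficient has only prime factors up to 2n, each with prime power
  at most 2n, so it is at most (2n)^\<pi>(2n). Compare with the lower bound 4^n / (2n) and take
  logarithms.\<close>

lemma primes_count_lower:
  assumes "n > 0"
  shows "real (card {p. prime p \<and> p \<le> 2 * n}) * ln (2 * real n) \<ge> real n * ln 4 - ln (2 * real n)"
proof -
  let ?B = "2 * n choose n"
  have fin: "finite {p::nat. prime p \<and> p \<le> 2 * n}" by (rule finite_subset[of _ "{..2 * n}"]) auto
  have sub: "prime_factors ?B \<subseteq> {p. prime p \<and> p \<le> 2 * n}"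
  proof
    fix p assume "p \<in> prime_factors ?B"
    then have p: "prime p" "p dvd ?B" by auto
    have "p dvd fact n * fact (2 * n - n) * ?B" using p by simp
    then have "p dvd (fact (2 * n) :: nat)" using binomial_fact_lemma[of n "2 * n"] by simp
    then show "p \<in> {p. prime p \<and> p \<le> 2 * n}" using p by (simp add: prime_dvd_fact_iff)
  qed
  have B: "?B > 0" by simp
  then have "?B = (\<Prod>p\<in>prime_factors ?B. p ^ multiplicity p ?B)" by (simp add: prod_prime_factors)
  also have "\<dots> \<le> (\<Prod>p\<in>prime_factors ?B. 2 * n)"
    using assms by (intro prod_mono) (auto intro!: prime_power_central_binomial_le)
  also have "\<dots> \<le> (2 * n) ^ card {p. prime p \<and> p \<le> 2 * n}"
    unfolding prod_constant using assms by (intro power_increasing card_mono[OF fin sub]) auto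
  finally have "real ?B \<le> (2 * real n) ^ card {p. prime p \<and> p \<le> 2 * n}"
    by (metis of_nat_le_iff of_nat_mult of_nat_numeral of_nat_power)
  moreover have "4 ^ n / (2 * real n) \<le> real ?B" by (rule central_binomial_lower_bound[OF assms])
  ultimately have "4 ^ n / (2 * real n) \<le> (2 * real n) ^ card {p. prime p \<and> p \<le> 2 * n}" by linarith
  then have "ln (4 ^ n / (2 * real n)) \<le> ln ((2 * real n) ^ card {p. prime p \<and> p \<le> 2 * n})"
    using assms by (intro ln_mono) auto
  also have "\<dots> = real (card {p. prime p \<and> p \<le> 2 * n}) * ln (2 * real n)"
    by (rule ln_realpow)
  finally show ?thesis using assms by (simp add: ln_div ln_realpow)
qed

lemma eventually_many_primes:
  "\<forall>\<^sub>F x in at_top. x / (4 * ln x) \<le> real (card {p. prime p \<and> sqrt x < real p \<and> real p \<le> x})"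
proof -
  \<comment> \<open>The right side is asymptotic to x / (2 ln x), twice the left, which pays for
    rounding x / 2 down and for discarding the at most sqrt x primes up to sqrt x.\<close>
  have "\<forall>\<^sub>F x::real in at_top. x / (4 * ln x) \<le> (x / 2 - 1 - ln x) / ln x - sqrt x"
    by real_asymp
  then show ?thesis using eventually_ge_at_top[of 4]
  proof eventually_elim
    case (elim x)
    define n where "n = nat \<lfloor>x / 2\<rfloor>"
    have n: "n > 0" "real n \<le> x / 2" "real n \<ge> x / 2 - 1" unfolding n_def using elim by linarith+
    have lnx: "ln x > 0" using elim by simp
    define A where "A = {p. prime p \<and> sqrt x < real p \<and> real p \<le> x}"
    have finA: "finite A" unfolding A_def by (rule finite_subset[of _ "{..nat \<lfloor>x\<rfloor>}"]) (auto simp: le_nat_floor)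
    have "{p. prime p \<and> p \<le> 2 * n} \<subseteq> A \<union> {1..nat \<lfloor>sqrt x\<rfloor>}"
    proof
      fix p assume "p \<in> {p. prime p \<and> p \<le> 2 * n}"
      then have p: "prime p" "p \<le> 2 * n" by auto
      then have "real p \<le> x" using n by linarith
      then show "p \<in> A \<union> {1..nat \<lfloor>sqrt x\<rfloor>}"
        using p prime_ge_1_nat[of p] by (cases "real p \<le> sqrt x") (auto simp: A_def le_nat_floor)
    qed
    then have "card {p. prime p \<and> p \<le> 2 * n} \<le> card (A \<union> {1..nat \<lfloor>sqrt x\<rfloor>})"
      using finA by (intro card_mono) auto
    also have "\<dots> \<le> card A + nat \<lfloor>sqrt x\<rfloor>" using card_Un_le[of A "{1..nat \<lfloor>sqrt x\<rfloor>}"] by simp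
    finally have "real (card {p. prime p \<and> p \<le> 2 * n}) \<le> real (card A) + real (nat \<lfloor>sqrt x\<rfloor>)" by linarith
    moreover have "real (nat \<lfloor>sqrt x\<rfloor>) \<le> sqrt x" using elim by simp
    ultimately have card: "real (card {p. prime p \<and> p \<le> 2 * n}) \<le> real (card A) + sqrt x" by linarith
    have "ln (2 * real n) \<le> ln x" using n elim by (intro ln_mono) auto
    moreover have "x / 2 - 1 \<le> real n * ln 4"
    proof -
      have "exp 1 \<le> (4::real)" using exp_le by simp
      then have "1 \<le> ln (4::real)" by (simp add: ln_ge_iff)
      then have "real n * 1 \<le> real n * ln 4" by (intro mult_left_mono) auto
      with n show ?thesis by linarith
    qed
    moreover have "real (card {p. prime p \<and> p \<le> 2 * n}) * ln (2 * real n) \<le> real (card {p. prime p \<and> p \<le> 2 * n}) * ln x"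
      using \<open>ln (2 * real n) \<le> ln x\<close> by (intro mult_left_mono) auto
    ultimately have "x / 2 - 1 - ln x \<le> real (card {p. prime p \<and> p \<le> 2 * n}) * ln x"
      using primes_count_lower[OF n(1)] by linarith
    then have "(x / 2 - 1 - ln x) / ln x \<le> real (card {p. prime p \<and> p \<le> 2 * n})"
      using lnx by (simp add: pos_divide_le_eq)
    with elim card show ?case unfolding A_def[symmetric] by linarith
  qed
qed

section \<open>Sharpness and the theorem\<close>

lemma prime_factorization_prod_primes:
  assumes "finite X" "\<And>p. p \<in> X \<Longrightarrow> prime (p::nat)"
  shows "prime_factorization (\<Prod>X) = mset_set X"
proof -
  have "(\<Prod>X) = \<Prod>\<^sub># (mset_set X)" by (simp add: prod_unfold_prod_mset)
  moreover have "prime_factorization (\<Prod>\<^sub># (mset_set X)) = mset_set X"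
    by (rule prime_factorization_prod_mset_primes) (use assms in simp)
  ultimately show ?thesis by simp
qed

lemma Omega_mult_prod_primes:
  assumes "finite X" "\<And>p. p \<in> X \<Longrightarrow> prime (p::nat)" "Q > 0"
  shows "Omega (Q * \<Prod>X) = Omega Q + card X"
proof -
  have "0 \<notin> X" using assms(2)[of 0] by auto
  then have "prime_factorization (Q * \<Prod>X) = prime_factorization Q + prime_factorization (\<Prod>X)"
    using assms by (intro prime_factorization_mult) auto
  then show ?thesis using prime_factorization_prod_primes[OF assms(1,2)] by (simp add: Omega_def)
qed

lemma inj_on_prod_primes:
  assumes "finite S" "\<And>p. p \<in> S \<Longrightarrow> prime (p::nat)" "Q > 0"
  shows "inj_on (\<lambda>X. Q * \<Prod>X) (Pow S)"
proof (rule inj_onI)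
  fix X Y assume XY: "X \<in> Pow S" "Y \<in> Pow S" "Q * \<Prod>X = Q * \<Prod>Y"
  then have fin: "finite X" "finite Y" using assms finite_subset by auto
  have "\<Prod>X = \<Prod>Y" using XY assms by simp
  then have "mset_set X = mset_set Y"
    using prime_factorization_prod_primes[OF fin(1)] prime_factorization_prod_primes[OF fin(2)] XY(1,2) assms(2)
    by (metis PowD subsetD)
  then show "X = Y" using fin by (metis finite_set_mset_mset_set)
qed

text \<open>Take b, a and G from subsets of S with j, r and r + j elements, with a factor Q in b and
  G. Each N in G has (r+j choose j) splittings, each contributing at least \<kappa> ln N. A fixed Q
  treats m = 2 (a large prime, j = 1) and m >= 3 (Q = 1, j = m) together.\<close>

lemma volterra_ineq_prime_sets:
  fixes S :: "nat set" and w :: "nat \<Rightarrow> real"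
  assumes ineq: "volterra_ineq m w"
    and S: "finite S" "\<And>p. p \<in> S \<Longrightarrow> prime p" "card S = 2 * r" "1 \<le> j" "j \<le> r"
    and Q: "Q > 0" "Omega Q + j = m"
    and \<kappa>: "\<kappa> \<ge> 0" "\<And>X Y. X \<subseteq> Y \<Longrightarrow> Y \<subseteq> S \<Longrightarrow> card X = j \<Longrightarrow> card Y = r + j \<Longrightarrow> \<kappa> * ln (real (Q * \<Prod>Y)) \<le> ln (real (Q * \<Prod>X))"
    and W: "\<And>X. X \<subseteq> S \<Longrightarrow> card X = j \<Longrightarrow> 0 \<le> w (Q * \<Prod>X) \<and> w (Q * \<Prod>X) \<le> W"
  shows "\<kappa>\<^sup>2 * real r ^ j \<le> (2 * (real j)\<^sup>2) ^ j * W"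
proof -
  define sets where "sets = (\<lambda>k. {X. X \<subseteq> S \<and> card X = k})"
  define E where "E = (\<lambda>X. Q * \<Prod>X) ` sets j"
  define G where "G = (\<lambda>X. Q * \<Prod>X) ` sets (r + j)"
  \<comment> \<open>The factor 1 gives A the same shape as E and G, so one injectivity fact serves
    all three.\<close>
  define A where "A = (\<lambda>X. 1 * \<Prod>X) ` sets r"
  have fin_sets: "finite (sets k)" for k unfolding sets_def using S(1) by simp
  have card_sets: "card (sets k) = (2 * r) choose k" for k
    unfolding sets_def using n_subsets[OF S(1)] S(3) by simp
  have fin: "finite X" if "X \<subseteq> S" for X using that S(1) finite_subset by blast
  have prod_ge1: "\<Prod>X \<ge> 1" if "X \<subseteq> S" for X
    by (rule prod_ge_1) (use that S(2) prime_ge_1_nat in blast)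
  have inj: "inj_on (\<lambda>X. q * \<Prod>X) (sets k)" if "q > 0" for q k
    by (rule inj_on_subset[OF inj_on_prod_primes[OF S(1,2) that]]) (auto simp: sets_def)
  have cards: "card E = (2 * r) choose j" "card G = (2 * r) choose (r + j)" "card A = (2 * r) choose r"
    unfolding E_def G_def A_def using inj Q(1) by (simp_all only: card_image card_sets zero_less_one)
  have rj: "(r + j choose j) \<noteq> 0" by simp
  have main: "(\<kappa> * real (r + j choose j))\<^sup>2 * real (card G) \<le> (\<Sum>n\<in>E. w n) * real (card A)"
  proof (rule volterra_ineq_finite[OF ineq])
    show "finite E" "finite G" "finite A" unfolding E_def G_def A_def using fin_sets by auto
    show "E \<subseteq> {n. 1 \<le> n \<and> Omega n = m}"
    proof
      fix n assume "n \<in> E"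
      then obtain X where X: "n = Q * \<Prod>X" "X \<subseteq> S" "card X = j" by (auto simp: E_def sets_def)
      then have "Omega n = m" using Omega_mult_prod_primes[OF fin[OF X(2)], of Q] S(2) Q by auto
      moreover have "n \<ge> 1" using X(1) Q(1) prod_ge1[OF X(2)] by (simp add: Suc_leI)
      ultimately show "n \<in> {n. 1 \<le> n \<and> Omega n = m}" by simp
    qed
    show "\<And>n. n \<in> E \<Longrightarrow> 0 \<le> w n" using W by (auto simp: E_def sets_def)
    show "A \<subseteq> {1..}" using prod_ge1 by (auto simp: A_def sets_def)
    have "card A > 0" using cards by (simp add: zero_less_binomial_iff)
    then show "A \<noteq> {}" by auto
    show "0 \<le> \<kappa> * real (r + j choose j)" using \<kappa>(1) by simp
    fix N assume "N \<in> G"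
    then obtain Y where Y: "N = Q * \<Prod>Y" "Y \<subseteq> S" "card Y = r + j" by (auto simp: G_def sets_def)
    have "finite Y" by (rule fin[OF Y(2)])
    have "2 \<le> \<Prod>Y"
    proof -
      have "Y \<noteq> {}" using Y(3) S(4) by auto
      then obtain p where p: "p \<in> Y" by blast
      have "p dvd \<Prod>Y" using dvd_prodI[OF \<open>finite Y\<close> p, of "\<lambda>x. x"] by simp
      then have "p \<le> \<Prod>Y" by (rule dvd_imp_le) (use prod_ge1[OF Y(2)] in simp)
      moreover have "p \<ge> 2" using p Y(2) S(2) prime_ge_2_nat by blast
      ultimately show ?thesis by simp
    qed
    then show "2 \<le> N" using Y(1) Q(1) by (metis le_trans mult_le_mono1 Suc_leI One_nat_def mult_1)
    \<comment> \<open>For X in T, the divisor Q times the product of X leaves the product over the r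
      primes of Y - X, an element of A.\<close>
    define T where "T = {X. X \<subseteq> Y \<and> card X = j}"
    have cardT: "card T = (r + j choose j)" unfolding T_def using n_subsets[OF \<open>finite Y\<close>] Y(3) by simp
    have "\<kappa> * real (r + j choose j) * ln (real N) = (\<Sum>X\<in>T. \<kappa> * ln (real N))" by (simp add: cardT)
    also have "\<dots> \<le> (\<Sum>X\<in>T. ln (real (Q * \<Prod>X)))"
      unfolding Y(1) by (intro sum_mono \<kappa>(2)) (use Y in \<open>auto simp: T_def\<close>)
    also have "\<dots> = (\<Sum>n\<in>(\<lambda>X. Q * \<Prod>X) ` T. ln (real n))"
    proof (subst sum.reindex)
      show "inj_on (\<lambda>X. Q * \<Prod>X) T"
        by (rule inj_on_subset[OF inj_on_prod_primes[OF S(1,2) Q(1)]]) (use Y in \<open>auto simp: T_def\<close>)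
    qed (simp add: o_def)
    also have "\<dots> \<le> (\<Sum>n | n \<in> E \<and> n dvd N \<and> N div n \<in> A. ln (real n))"
    proof (rule sum_mono2)
      show "finite {n \<in> E. n dvd N \<and> N div n \<in> A}" unfolding E_def using fin_sets by auto
      show "(\<lambda>X. Q * \<Prod>X) ` T \<subseteq> {n \<in> E. n dvd N \<and> N div n \<in> A}"
      proof (safe)
        fix X assume "X \<in> T"
        then have X: "X \<subseteq> Y" "card X = j" "finite X" using \<open>finite Y\<close> finite_subset by (auto simp: T_def)
        have split: "\<Prod>Y = \<Prod>X * \<Prod>(Y - X)"
          using prod.subset_diff[OF X(1) \<open>finite Y\<close>, of "\<lambda>x. x"] by (simp add: mult.commute)
        show "Q * \<Prod>X \<in> E" using X Y by (auto simp: E_def sets_def)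
        show "Q * \<Prod>X dvd N" unfolding Y(1) split by simp
        have "Q * \<Prod>X > 0" using Q(1) prod_ge1[of X] X Y by (simp add: Suc_le_eq)
        then have "N div (Q * \<Prod>X) = \<Prod>(Y - X)"
          unfolding Y(1) split by (metis mult.assoc nonzero_mult_div_cancel_left less_numeral_extra(3))
        moreover have "card (Y - X) = r" using X Y \<open>finite Y\<close> by (simp add: card_Diff_subset)
        then have "\<Prod>(Y - X) \<in> A" unfolding A_def sets_def using Y by (intro image_eqI[of _ _ "Y - X"]) auto
        ultimately show "N div (Q * \<Prod>X) \<in> A" by simp
      qed
    qed (simp add: ln_of_nat_nonneg)
    finally show "\<kappa> * real (r + j choose j) * ln (real N) \<le> (\<Sum>n | n \<in> E \<and> n dvd N \<and> N div n \<in> A. ln (real n))" .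
  qed
  have "j \<le> card S" using S by simp
  then obtain X where "X \<subseteq> S" "card X = j" by (rule obtain_subset_with_card_n)
  then have Wnn: "W \<ge> 0" using W[of X] by linarith
  have "(\<Sum>n\<in>E. w n) \<le> (\<Sum>n\<in>E. W)" using W by (intro sum_mono) (auto simp: E_def sets_def)
  then have wE: "(\<Sum>n\<in>E. w n) \<le> real (2 * r choose j) * W" by (simp add: cards)
  \<comment> \<open>Both sides count the choices of an r-set together with a disjoint j-set in a set
    of 2r elements. This exposes (2r choose r), which is then cancelled.\<close>
  have choose: "real (2 * r choose (r + j)) * real (r + j choose j) = real (2 * r choose r) * real (r choose j)"
  proof -
    have "(2 * r choose (r + j)) * (r + j choose r) = (2 * r choose r) * ((2 * r - r) choose (r + j - r))"
      by (rule choose_mult) (use S(5) in auto)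
    then have "(2 * r choose (r + j)) * (r + j choose j) = (2 * r choose r) * (r choose j)"
      using binomial_symmetric[of j "r + j"] by simp
    then show ?thesis by (metis of_nat_mult)
  qed
  have "\<kappa>\<^sup>2 * real (r + j choose j) * (real (2 * r choose (r + j)) * real (r + j choose j)) \<le> real (2 * r choose j) * W * real (2 * r choose r)"
    using order_trans[OF main mult_right_mono[OF wE]] by (simp add: cards power2_eq_square mult_ac)
  then have "(\<kappa>\<^sup>2 * real (r + j choose j) * real (r choose j)) * real (2 * r choose r) \<le> (real (2 * r choose j) * W) * real (2 * r choose r)"
    unfolding choose by (simp add: mult_ac)
  then have 1: "\<kappa>\<^sup>2 * real (r + j choose j) * real (r choose j) \<le> real (2 * r choose j) * W"
    by (rule mult_right_le_imp_le) (simp add: zero_less_binomial_iff)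
  \<comment> \<open>Both binomials on the left are at least (r / j)^j and the one on the right is at
    most (2r)^j; clearing j and cancelling r^j leaves the stated inequality.\<close>
  have c: "(real r / real j) ^ j \<le> real (r choose j)" using binomial_ge_n_over_k_pow_k[OF S(5)] by simp
  have "r choose j \<le> (r + j) choose j" by (rule binomial_right_mono) simp
  then have c': "(real r / real j) ^ j \<le> real (r + j choose j)" using c by linarith
  have "\<kappa>\<^sup>2 * ((real r / real j) ^ j * (real r / real j) ^ j) \<le> \<kappa>\<^sup>2 * (real (r + j choose j) * real (r choose j))"
    using c c' by (intro mult_left_mono mult_mono) auto
  also have "\<dots> \<le> real (2 * r choose j) * W" using 1 by (simp add: mult.assoc)
  also have "\<dots> \<le> (2 * real r) ^ j * W"
  proof (rule mult_right_mono[OF _ Wnn])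
    have "(2 * r choose j) \<le> (2 * r) ^ j" by (rule binomial_le_pow) (use S(5) in simp)
    then show "real (2 * r choose j) \<le> (2 * real r) ^ j" by (metis of_nat_le_iff of_nat_mult of_nat_numeral of_nat_power)
  qed
  finally have "\<kappa>\<^sup>2 * ((real r / real j) ^ j * (real r / real j) ^ j) \<le> (2 * real r) ^ j * W" .
  then have "\<kappa>\<^sup>2 * ((real r / real j) ^ j * (real r / real j) ^ j) * ((real j)\<^sup>2) ^ j \<le> (2 * real r) ^ j * W * ((real j)\<^sup>2) ^ j"
    by (rule mult_right_mono) simp
  also have "\<kappa>\<^sup>2 * ((real r / real j) ^ j * (real r / real j) ^ j) * ((real j)\<^sup>2) ^ j = \<kappa>\<^sup>2 * real r ^ j * real r ^ j"
  proof -
    have "(real r / real j) ^ j * (real r / real j) ^ j * ((real j)\<^sup>2) ^ j = (real r / real j * (real r / real j) * (real j)\<^sup>2) ^ j"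
      by (simp only: power_mult_distrib)
    also have "real r / real j * (real r / real j) * (real j)\<^sup>2 = real r * real r"
      using S(4) by (simp add: power2_eq_square)
    finally show ?thesis by (simp only: power_mult_distrib mult.assoc)
  qed
  also have "(2 * real r) ^ j * W * ((real j)\<^sup>2) ^ j = (2 * (real j)\<^sup>2) ^ j * W * real r ^ j"
    by (simp add: power_mult_distrib mult_ac)
  finally show ?thesis by (rule mult_right_le_imp_le) (use S in simp)
qed

text \<open>r is x / (8 ln x) rounded down; the weaker constant 16 below absorbs the rounding.
  Primes above sqrt x have logarithms within a factor 2 of ln x.\<close>

lemma eventually_prime_set:
  "\<forall>\<^sub>F x::real in at_top. \<exists>S r. finite S \<and> (\<forall>p\<in>S. prime (p::nat) \<and> sqrt x < real p \<and> real p \<le> x) \<and>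
     card S = 2 * r \<and> x / (16 * ln x) \<le> real r \<and> real r \<le> x / (8 * ln x)"
proof -
  have "\<forall>\<^sub>F x::real in at_top. x / (16 * ln x) \<le> x / (8 * ln x) - 1" by real_asymp
  then show ?thesis using eventually_many_primes eventually_gt_at_top[of 1]
  proof eventually_elim
    case (elim x)
    define A where "A = {p. prime p \<and> sqrt x < real p \<and> real p \<le> x}"
    define r where "r = nat \<lfloor>x / (8 * ln x)\<rfloor>"
    have "x / (8 * ln x) \<ge> 0" using elim by simp
    then have r: "real r \<le> x / (8 * ln x)" "x / (8 * ln x) - 1 \<le> real r" unfolding r_def by linarith+
    have "real (2 * r) \<le> x / (4 * ln x)" using r by simp
    also have "\<dots> \<le> real (card A)" using elim unfolding A_def by simp
    finally have "2 * r \<le> card A" by (simp only: of_nat_le_iff)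
    then obtain S where S: "S \<subseteq> A" "card S = 2 * r" "finite S" by (rule obtain_subset_with_card_n)
    show ?case
      using S r elim(1) by (intro exI[of _ S] exI[of _ r]) (auto simp: A_def)
  qed
qed

lemma ln_real_prod:
  assumes "finite X" "\<And>p. p \<in> X \<Longrightarrow> (p::nat) > 0"
  shows "ln (real (\<Prod>X)) = (\<Sum>p\<in>X. ln (real p))"
  unfolding of_nat_prod using assms by (intro ln_prod) auto

text \<open>With ln q = x, the prime q dominates: r + 1 primes up to x have logarithms of total at
  most x, so each q p in E carries at least half of ln N and \<kappa> = 1/2. The test inequality
  then bounds r by O(x / (ln x)^(1+\<epsilon>)), against r >= x / (16 ln x).\<close>

lemma volterra_ineq_2_not:
  assumes "\<epsilon> > 0" "C > 0"
  shows "\<not> volterra_ineq 2 (\<lambda>n. C * ln (real n) / loglog (real n) powr (1 + \<epsilon>))"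
proof
  define w where "w = (\<lambda>n. C * ln (real n) / loglog (real n) powr (1 + \<epsilon>))"
  assume "volterra_ineq 2 (\<lambda>n. C * ln (real n) / loglog (real n) powr (1 + \<epsilon>))"
  then have ineq: "volterra_ineq 2 w" by (simp add: w_def)
  have "\<forall>\<^sub>F x::real in at_top. 1 \<le> x / (16 * ln x)" by real_asymp
  moreover have "\<forall>\<^sub>F x::real in at_top. x / (8 * ln x) * ln x + ln x \<le> x" by real_asymp
  moreover have "\<forall>\<^sub>F x::real in at_top. 256 * C < ln x powr \<epsilon>" using assms(1) by real_asymp
  \<comment> \<open>Only x of the form ln q are usable, so the contradiction is stated as the
    absence of large primes and later refuted by Euclid's theorem.\<close>
  ultimately have "\<forall>\<^sub>F x in at_top. \<forall>q. \<not> (prime q \<and> x = ln (real q))"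
    using eventually_prime_set eventually_gt_at_top[of "exp 1"]
  proof eventually_elim
    case (elim x)
    show ?case
    proof (intro allI notI)
      fix q assume "prime q \<and> x = ln (real q)"
      then have q: "prime q" "x = ln (real q)" by auto
      obtain S r where S: "finite S" "\<And>p. p \<in> S \<Longrightarrow> prime p" "\<And>p. p \<in> S \<Longrightarrow> sqrt x < real p" "\<And>p. p \<in> S \<Longrightarrow> real p \<le> x"
        "card S = 2 * r" and r: "x / (16 * ln x) \<le> real r" "real r \<le> x / (8 * ln x)"
        using elim(4) by blast
      have x: "x > exp 1" "x > 1" using elim(5) exp_gt_one[of 1] by linarith+
      then have lnx: "ln x > 1" by (metis exp_gt_zero ln_exp ln_less_cancel_iff less_trans)
      have q0: "q > 0" using q by (simp add: prime_gt_0_nat)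
      have Spos: "p > 0" if "p \<in> S" for p using S(2)[OF that] by (rule prime_gt_0_nat)
      have subset: "\<And>p. p \<in> X \<Longrightarrow> p > 0" "finite X" if "X \<subseteq> S" for X
        using that S(1) Spos by (auto intro: finite_subset)
      have pos: "\<Prod>X > 0" if "X \<subseteq> S" for X using subset[OF that] by (auto intro: prod_pos)
      have ln_q: "ln (real (q * \<Prod>X)) = x + (\<Sum>p\<in>X. ln (real p))" if "X \<subseteq> S" for X
        using pos[OF that] q0 q(2) ln_real_prod[OF subset(2,1)[OF that]] by (simp add: ln_mult del: of_nat_prod)
      have sum_le: "(\<Sum>p\<in>X. ln (real p)) \<le> real (card X) * ln x" if "X \<subseteq> S" for X
      proof (rule sum_bounded_above)
        fix p assume "p \<in> X"
        then show "ln (real p) \<le> ln x" using that S(4) subset(1)[OF that] by (intro ln_mono) auto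
      qed
      have "(1/2)\<^sup>2 * real r ^ 1 \<le> (2 * (real 1)\<^sup>2) ^ 1 * (C * (2 * x) / ln x powr (1 + \<epsilon>))"
      proof (rule volterra_ineq_prime_sets[OF ineq S(1,2,5)])
        show "1 \<le> r" using elim(1) r by linarith
        show "Omega q + 1 = 2" using q by (simp add: Omega_def prime_factorization_prime)
        fix X Y assume XY: "X \<subseteq> Y" "Y \<subseteq> S" "card X = 1" "card Y = r + 1"
        have "(\<Sum>p\<in>Y. ln (real p)) \<le> (real r + 1) * ln x" using sum_le[OF XY(2)] XY(4) by (simp add: add.commute)
        also have "\<dots> \<le> x / (8 * ln x) * ln x + ln x" using mult_right_mono[OF r(2), of "ln x"] lnx
          by (simp only: distrib_right mult_1) linarith
        also have "\<dots> \<le> x" by (rule elim(2))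
        finally have "1/2 * ln (real (q * \<Prod>Y)) \<le> x" using ln_q[OF XY(2)] by simp
        also have "\<dots> \<le> ln (real (q * \<Prod>X))"
          using ln_q[of X] XY by (auto intro!: sum_nonneg ln_of_nat_nonneg)
        finally show "1/2 * ln (real (q * \<Prod>Y)) \<le> ln (real (q * \<Prod>X))" .
      next
        fix X assume X: "X \<subseteq> S" "card X = 1"
        define n where "n = real (q * \<Prod>X)"
        have ln_n: "ln n \<ge> x" "ln n \<le> 2 * x"
        proof -
          show "ln n \<ge> x" unfolding n_def ln_q[OF X(1)] by (auto intro!: sum_nonneg ln_of_nat_nonneg)
          have "(\<Sum>p\<in>X. ln (real p)) \<le> ln x" using sum_le[OF X(1)] X(2) by simp
          also have "\<dots> \<le> x" using x ln_le_minus_one[of x] by linarith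
          finally show "ln n \<le> 2 * x" unfolding n_def ln_q[OF X(1)] by simp
        qed
        have n0: "n > 0" unfolding n_def using q0 pos[OF X(1)] by (simp del: of_nat_prod)
        have "n > exp (exp 1)" using ln_n(1) x n0 by (metis exp_less_mono exp_ln less_le_trans)
        then have "loglog n = ln (ln n)" by (simp add: loglog_def)
        moreover have "ln x \<le> ln (ln n)" using ln_n x by (intro ln_mono) auto
        ultimately have "ln x powr (1 + \<epsilon>) \<le> loglog n powr (1 + \<epsilon>)" using lnx assms(1) by (intro powr_mono2) auto
        then have "C * ln n / loglog n powr (1 + \<epsilon>) \<le> C * (2 * x) / ln x powr (1 + \<epsilon>)"
          using ln_n lnx assms x by (intro frac_le mult_left_mono) auto
        moreover have "0 \<le> C * ln n / loglog n powr (1 + \<epsilon>)" using assms ln_n x by simp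
        ultimately show "0 \<le> w (q * \<Prod>X) \<and> w (q * \<Prod>X) \<le> C * (2 * x) / ln x powr (1 + \<epsilon>)"
          by (simp only: w_def n_def)
      qed (use q0 in auto)
      \<comment> \<open>16 = 4 * 2 * 2, from \<kappa>^2 = 1/4, the factor 2 j^2 and ln n <= 2
        x.\<close>
      then have "real r \<le> 16 * C * x / ln x powr (1 + \<epsilon>)" by (simp add: power2_eq_square)
      with r(1) have "x / (16 * ln x) \<le> 16 * C * x / ln x powr (1 + \<epsilon>)" by linarith
      also have "ln x powr (1 + \<epsilon>) = ln x * ln x powr \<epsilon>" using lnx by (simp add: powr_add)
      finally have "ln x powr \<epsilon> \<le> 256 * C" using lnx x by (simp add: field_simps)
      with elim(3) show False by simp
    qed
  qed
  then obtain x0 where x0: "\<And>x q. x \<ge> x0 \<Longrightarrow> \<not> (prime q \<and> x = ln (real q))"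
    unfolding eventually_at_top_linorder by blast
  obtain q :: nat where q: "prime q" "q > nat \<lceil>exp x0\<rceil>" using bigger_prime by blast
  then have "exp x0 \<le> real q" by linarith
  then have "x0 \<le> ln (real q)" using q by (simp add: ln_ge_iff prime_gt_0_nat)
  with x0 q show False by blast
qed

text \<open>Every n in E has ln n between ln x and m ln x, and every N in G has at most 2r prime
  factors up to x, so \<kappa> = 1 / (4r) works. The test inequality becomes r^(m-2) = O(W) with W
  of order (x / ln x)^(m-2) / (ln x)^\<epsilon>, which contradicts r >= x / (16 ln x).\<close>

lemma volterra_ineq_ge_3_not:
  assumes m: "m \<ge> 3" and "\<epsilon> > 0" "C > 0"
  shows "\<not> volterra_ineq m (\<lambda>n. C * real n powr ((real m - 2) / real m) / ln (real n) powr (real m + \<epsilon> - 2))"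
proof
  define w where "w = (\<lambda>n. C * real n powr ((real m - 2) / real m) / ln (real n) powr (real m + \<epsilon> - 2))"
  assume "volterra_ineq m (\<lambda>n. C * real n powr ((real m - 2) / real m) / ln (real n) powr (real m + \<epsilon> - 2))"
  then have ineq: "volterra_ineq m w" by (simp add: w_def)
  \<comment> \<open>Collects 1 / (\<kappa> r)^2 = 16, the constant of the prime-set inequality, C,
    and 16^(m-2) from the lower bound for r.\<close>
  define D where "D = 16 * (2 * (real m)\<^sup>2) ^ m * C * 16 ^ (m - 2)"
  define \<mu> where "\<mu> = real m"
  have "\<forall>\<^sub>F x::real in at_top. \<mu> \<le> x / (16 * ln x)" by real_asymp
  moreover have "\<forall>\<^sub>F x::real in at_top. D < ln x powr \<epsilon>" using assms(2) by real_asymp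
  ultimately have "\<forall>\<^sub>F x::real in at_top. False"
    using eventually_prime_set eventually_gt_at_top[of "exp 1"]
  proof eventually_elim
    case (elim x)
    obtain S r where S: "finite S" "\<And>p. p \<in> S \<Longrightarrow> prime p" "\<And>p. p \<in> S \<Longrightarrow> sqrt x < real p" "\<And>p. p \<in> S \<Longrightarrow> real p \<le> x"
      "card S = 2 * r" and r: "x / (16 * ln x) \<le> real r" "real r \<le> x / (8 * ln x)"
      using elim(3) by blast
    have x: "x > exp 1" "x > 1" using elim(4) exp_gt_one[of 1] by linarith+
    then have lnx: "ln x > 1" by (metis exp_gt_zero ln_exp ln_less_cancel_iff less_trans)
    have rm: "m \<le> r" using elim(1) r(1) unfolding \<mu>_def by linarith
    then have r0: "real r > 0" using m by simp
    have Spos: "p > 0" if "p \<in> S" for p using S(2)[OF that] by (rule prime_gt_0_nat)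
    have subset: "\<And>p. p \<in> X \<Longrightarrow> p > 0" "finite X" if "X \<subseteq> S" for X
      using that S(1) Spos by (auto intro: finite_subset)
    have pos: "\<Prod>X > 0" if "X \<subseteq> S" for X using subset[OF that] by (auto intro: prod_pos)
    have ln_prod: "ln (real (1 * \<Prod>X)) = (\<Sum>p\<in>X. ln (real p))" if "X \<subseteq> S" for X
      using ln_real_prod[OF subset(2,1)[OF that]] by (simp del: of_nat_prod)
    have sum_le: "(\<Sum>p\<in>X. ln (real p)) \<le> real (card X) * ln x" if "X \<subseteq> S" for X
    proof (rule sum_bounded_above)
      fix p assume "p \<in> X"
      then show "ln (real p) \<le> ln x" using that S(4) subset(1)[OF that] by (intro ln_mono) auto
    qed
    have sum_ge: "real (card X) * (ln x / 2) \<le> (\<Sum>p\<in>X. ln (real p))" if "X \<subseteq> S" for X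
    proof (rule sum_bounded_below)
      fix p assume "p \<in> X"
      then have "sqrt x < real p" using that S(3) by blast
      then have "ln (sqrt x) \<le> ln (real p)" using x by (intro ln_mono) auto
      then show "ln x / 2 \<le> ln (real p)" using x by (simp add: ln_sqrt)
    qed
    define W where "W = C * x powr (real m - 2) / ln x powr (real m + \<epsilon> - 2)"
    have "(1 / (4 * real r))\<^sup>2 * real r ^ m \<le> (2 * (real m)\<^sup>2) ^ m * W"
    proof (rule volterra_ineq_prime_sets[OF ineq S(1,2,5)])
      show "1 \<le> m" "m \<le> r" using m rm by auto
      show "Omega 1 + m = m" by (simp add: Omega_def)
      fix X Y assume XY: "X \<subseteq> Y" "Y \<subseteq> S" "card X = m" "card Y = r + m"
      have "ln (real (1 * \<Prod>Y)) \<le> real (r + m) * ln x" using sum_le[OF XY(2)] ln_prod[OF XY(2)] XY(4) by simp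
      also have "\<dots> \<le> (2 * real r) * ln x" using rm lnx by (intro mult_right_mono) auto
      finally have "1 / (4 * real r) * ln (real (1 * \<Prod>Y)) \<le> 1 / (4 * real r) * ((2 * real r) * ln x)"
        using r0 by (intro mult_left_mono) auto
      also have "\<dots> = ln x / 2" using r0 by simp
      also have "\<dots> \<le> real m * (ln x / 2)" using m lnx mult_right_mono[of 1 "real m" "ln x / 2"] by simp
      also have "\<dots> \<le> ln (real (1 * \<Prod>X))" using sum_ge[of X] ln_prod[of X] XY by simp
      finally show "1 / (4 * real r) * ln (real (1 * \<Prod>Y)) \<le> ln (real (1 * \<Prod>X))" .
    next
      fix X assume X: "X \<subseteq> S" "card X = m"
      define n where "n = real (1 * \<Prod>X)"
      have n0: "n > 0" unfolding n_def using pos[OF X(1)] by (simp del: of_nat_prod)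
      have "real m * (ln x / 2) \<le> ln n" using sum_ge[OF X(1)] ln_prod[OF X(1)] X(2) by (simp add: n_def)
      \<comment> \<open>Each of the m >= 2 primes exceeds sqrt x, so together they reach ln
        x.\<close>
      moreover have "2 * (ln x / 2) \<le> real m * (ln x / 2)" using m lnx by (intro mult_right_mono) auto
      ultimately have ln_n: "ln x \<le> ln n" by simp
      have "ln n \<le> real m * ln x" using sum_le[OF X(1)] ln_prod[OF X(1)] X(2) by (simp add: n_def)
      then have "(real m - 2) / real m * ln n \<le> (real m - 2) / real m * (real m * ln x)"
        using m by (intro mult_left_mono) auto
      then have "(real m - 2) / real m * ln n \<le> (real m - 2) * ln x" using m by simp
      then have 1: "n powr ((real m - 2) / real m) \<le> x powr (real m - 2)"
        using n0 x by (simp add: powr_def)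
      have 2: "ln x powr (real m + \<epsilon> - 2) \<le> ln n powr (real m + \<epsilon> - 2)"
        using ln_n lnx m assms(2) by (intro powr_mono2) auto
      have "C * n powr ((real m - 2) / real m) / ln n powr (real m + \<epsilon> - 2) \<le> W"
        unfolding W_def using 1 2 lnx assms by (intro frac_le mult_left_mono) auto
      moreover have "0 \<le> C * n powr ((real m - 2) / real m) / ln n powr (real m + \<epsilon> - 2)" using assms by simp
      ultimately show "0 \<le> w (1 * \<Prod>X) \<and> w (1 * \<Prod>X) \<le> W"
        by (simp only: w_def n_def)
    qed (use r0 in auto)
    moreover have "real r ^ m = real r ^ (m - 2) * (real r)\<^sup>2"
    proof -
      have eq: "m - 2 + 2 = m" using m by simp
      show ?thesis using power_add[of "real r" "m - 2" 2] unfolding eq .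
    qed
    ultimately have "real r ^ (m - 2) \<le> 16 * (2 * (real m)\<^sup>2) ^ m * W"
      using r0 by (simp add: power_divide power_mult_distrib)
    moreover have "(x / (16 * ln x)) ^ (m - 2) \<le> real r ^ (m - 2)"
      using r(1) x lnx by (intro power_mono) auto
    ultimately have "(x / (16 * ln x)) ^ (m - 2) \<le> 16 * (2 * (real m)\<^sup>2) ^ m * W" by linarith
    moreover have "W = C * (x / ln x) ^ (m - 2) / ln x powr \<epsilon>"
    proof -
      have "x powr (real m - 2) = x ^ (m - 2)" "ln x powr (real m - 2) = ln x ^ (m - 2)"
        using m x lnx by (simp_all add: powr_realpow[symmetric] of_nat_diff)
      moreover have "ln x powr (real m + \<epsilon> - 2) = ln x powr (real m - 2) * ln x powr \<epsilon>"
        by (simp flip: powr_add add: algebra_simps)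
      ultimately show ?thesis by (simp add: W_def power_divide)
    qed
    moreover have "(x / (16 * ln x)) ^ (m - 2) = (x / ln x) ^ (m - 2) / 16 ^ (m - 2)"
      by (simp add: power_divide power_mult_distrib)
    ultimately have "(x / ln x) ^ (m - 2) / 16 ^ (m - 2) \<le> 16 * (2 * (real m)\<^sup>2) ^ m * (C * (x / ln x) ^ (m - 2) / ln x powr \<epsilon>)"
      by simp
    then have "(x / ln x) ^ (m - 2) * ln x powr \<epsilon> \<le> (x / ln x) ^ (m - 2) * D"
      using lnx by (simp add: D_def field_simps)
    moreover have "(x / ln x) ^ (m - 2) > 0" using x lnx by simp
    ultimately have "ln x powr \<epsilon> \<le> D" by simp
    with elim(2) show False by simp
  qed
  then show False by simp
qed

section \<open>The admissible weights\<close>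

text \<open>From 2^\<Omega>(n) <= n. It ensures ln n > 1, so the weights are positive.\<close>

lemma Omega_ge_2_imp: "n \<ge> 1 \<Longrightarrow> Omega n \<ge> 2 \<Longrightarrow> n \<ge> 4"
proof -
  assume n: "n \<ge> 1" "Omega n \<ge> 2"
  have "(2::nat) ^ size M \<le> \<Prod>\<^sub># M" if "\<And>p. p \<in># M \<Longrightarrow> p \<ge> 2" for M
    using that by (induction M) (auto intro!: mult_mono)
  from this[of "prime_factorization n"] have "2 ^ Omega n \<le> n"
    using n prime_factors_ge_2 by (simp add: Omega_def prod_mset_prime_factorization_nat)
  moreover have "(2::nat) ^ 2 \<le> 2 ^ Omega n" using n by (intro power_increasing) auto
  ultimately show "n \<ge> 4" by simp
qed

lemma divisors_Omega_eq:
  "N \<ge> 2 \<Longrightarrow> {n. n dvd N \<and> n \<in> {n. n \<ge> 1 \<and> Omega n = m}} = {n. n dvd N \<and> Omega n = m}"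
  using divisor_bounds(1)[of _ N] by auto

lemma volterra_ineq_2: "volterra_ineq 2 (\<lambda>n. 8 * (ln (real n) / loglog (real n)))"
\<comment> \<open>The weight is at least 1 because \<open>loglog n\<close> is at most ln n for n >=
  4.\<close>
proof (rule volterra_ineqI[of 1])
  fix n :: nat assume n: "n \<ge> 1" "Omega n = 2"
  then have "n \<ge> 4" using Omega_ge_2_imp by simp
  then have "exp 1 \<le> real n" using exp_le by linarith
  then have ln: "1 \<le> ln (real n)" using n by (simp add: ln_ge_iff)
  have "loglog (real n) \<le> ln (real n)"
    using ln ln_le_minus_one[of "ln (real n)"] by (auto simp: loglog_def)
  then show "1 \<le> ln (real n) / loglog (real n)" using loglog_ge_1[of "real n"] by simp
next
  fix N :: nat assume N: "N \<ge> 2"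
  have "(\<Sum>n | n dvd N \<and> Omega n = 2. (ln (real n))\<^sup>2 / (ln (real n) / loglog (real n))) =
      (\<Sum>n | n dvd N \<and> Omega n = 2. ln (real n) * loglog (real n))"
    by (intro sum.cong) (auto simp: power2_eq_square)
  then show "(\<Sum>n | n dvd N \<and> n \<in> {n. 1 \<le> n \<and> Omega n = 2}. (ln (real n))\<^sup>2 / (ln (real n) / loglog (real n))) \<le> 8 * (ln (real N))\<^sup>2"
    unfolding divisors_Omega_eq[OF N] using sum_Omega_2_le[OF N] by simp
qed auto

lemma volterra_ineq_ge_3:
  assumes m: "m \<ge> 3"
  shows "\<exists>C>0. volterra_ineq m (\<lambda>n. C * (real n powr ((real m - 2) / real m) / ln (real n) powr (real m - 2)))"
proof -
  obtain C where C: "C > 0" "\<And>N. N \<ge> 2 \<Longrightarrow>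
    (\<Sum>n | n dvd N \<and> Omega n = m. ln (real n) ^ m * real n powr (- ((real m - 2) / real m))) \<le> C * (ln (real N))\<^sup>2"
    using sum_Omega_weighted_le[OF m] by blast
  have "volterra_ineq m (\<lambda>n. C * (real n powr ((real m - 2) / real m) / ln (real n) powr (real m - 2)))"
  \<comment> \<open>This lower bound for the weight is the inequality ln n <= m n^(1/m) raised to
    the power m - 2.\<close>
  proof (rule volterra_ineqI[of "1 / real m powr (real m - 2)"])
    show "1 / real m powr (real m - 2) > 0" using m by simp
  next
    fix n :: nat assume n: "n \<ge> 1" "Omega n = m"
    then have "n \<ge> 4" using Omega_ge_2_imp m by simp
    then have ln: "ln (real n) > 0" by simp
    have "ln (real n) \<le> real n powr (1 / real m) / (1 / real m)" using n m by (intro ln_powr_bound) auto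
    then have "ln (real n) powr (real m - 2) \<le> (real m * real n powr (1 / real m)) powr (real m - 2)"
      using ln m by (intro powr_mono2) (auto simp: mult.commute)
    also have "\<dots> = real m powr (real m - 2) * real n powr ((real m - 2) / real m)"
      by (simp add: powr_mult powr_powr)
    finally show "1 / real m powr (real m - 2) \<le> real n powr ((real m - 2) / real m) / ln (real n) powr (real m - 2)"
      using ln m by (simp add: field_simps)
  next
    fix N :: nat assume N: "N \<ge> 2"
    have "(\<Sum>n | n dvd N \<and> Omega n = m. (ln (real n))\<^sup>2 / (real n powr ((real m - 2) / real m) / ln (real n) powr (real m - 2))) =
        (\<Sum>n | n dvd N \<and> Omega n = m. ln (real n) ^ m * real n powr (- ((real m - 2) / real m)))"
    proof (rule sum.cong)
      fix n assume "n \<in> {n. n dvd N \<and> Omega n = m}"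
      then have "n \<ge> 4" using Omega_ge_2_imp divisor_bounds(1)[of n N] N m by auto
      then have ln: "ln (real n) > 0" by simp
      have "ln (real n) powr (real m - 2) = ln (real n) ^ (m - 2)"
        using ln m by (simp add: powr_realpow[symmetric] of_nat_diff)
      moreover have "(ln (real n))\<^sup>2 * ln (real n) ^ (m - 2) = ln (real n) ^ m"
      proof -
        have eq: "2 + (m - 2) = m" using m by simp
        show ?thesis using power_add[of "ln (real n)" 2 "m - 2"] unfolding eq by simp
      qed
      ultimately show "(ln (real n))\<^sup>2 / (real n powr ((real m - 2) / real m) / ln (real n) powr (real m - 2)) =
          ln (real n) ^ m * real n powr (- ((real m - 2) / real m))"
        by (simp add: powr_minus divide_inverse)
    qed simp
    then show "(\<Sum>n | n dvd N \<and> n \<in> {n. 1 \<le> n \<and> Omega n = m}.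
        (ln (real n))\<^sup>2 / (real n powr ((real m - 2) / real m) / ln (real n) powr (real m - 2))) \<le> C * (ln (real N))\<^sup>2"
      unfolding divisors_Omega_eq[OF N] using C(2)[OF N] by simp
  qed (rule C(1))
  with C(1) show ?thesis by blast
qed

theorem theorem4p2:
  shows
   "((\<exists>C>0. volterra_ineq 2 (\<lambda>n. C * (ln (real n) / loglog (real n)))) \<and>
     (\<forall>\<epsilon>>0. \<not> (\<exists>C>0. volterra_ineq 2 (\<lambda>n. C * ln (real n) / loglog (real n) powr (1 + \<epsilon>))))) \<and>
    (\<forall>m::nat. m \<ge> 3 \<longrightarrow>
     (\<exists>C>0. volterra_ineq m
        (\<lambda>n. C * (real n powr ((real m - 2) / real m) / ln (real n) powr (real m - 2)))) \<and>
     (\<forall>\<epsilon>>0. \<not> (\<exists>C>0. volterra_ineq m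
        (\<lambda>n. C * real n powr ((real m - 2) / real m) / ln (real n) powr (real m + \<epsilon> - 2)))))"
proof (intro conjI allI impI)
  show "\<exists>C>0. volterra_ineq 2 (\<lambda>n. C * (ln (real n) / loglog (real n)))"
    using volterra_ineq_2 by (intro exI[of _ 8]) simp
qed (use volterra_ineq_2_not volterra_ineq_ge_3 volterra_ineq_ge_3_not in blast)+

end
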